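(* Let $\gamma\in\mathfrak{gl}_2(\mathfrak{o})$ be an elliptic regular semisimple element, i.e. its characteristic polynomial $\chi_\gamma(x)\in\mathfrak{o}[x]$ is irreducible (and separable) over $F$. Put $F_{\chi_\gamma}=F[x]/(\chi_\gamma(x))$. Then \[ \mathcal{SO}_{\gamma}=\begin{cases} q^{-S(\gamma)}\cdot \frac{q-1}{q}\left(1+(q+1)\cdot\frac{q^{S(\gamma)}-1}{q-1}\right)=\frac{q +1}{q}-\frac{2}{q^{S(\gamma)+1}} & \text{if } F_{\chi_{\gamma}}/F \text{ is unramified};\\[2mm] q^{-S(\gamma)}\cdot \frac{q^{2}-1 }{ q^{2}}\cdot\frac{q^{S(\gamma)+1}-1}{ q-1}=\frac{q+1}{q}-\frac{q+1}{q^{S(\gamma)+2}} & \text{if } F_{\chi_{\gamma}}/F \text{ is ramified}. \end{cases} \]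
   Context: $F$ is a non-Archimedean local field of arbitrary characteristic, $\mathfrak{o}$ its ring of integers, $\pi$ a uniformizer, $\kappa=\mathfrak{o}/\pi\mathfrak{o}$ the residue field, $q=\#\kappa$. For $\gamma\in\mathfrak{gl}_n(\mathfrak{o})$ write $\chi_\gamma(x)=x^n+c_1x^{n-1}+\dots+c_n$ for its characteristic polynomial; $\gamma$ is regular semisimple iff $\chi_\gamma$ is separable. Let $\varphi_n:\mathfrak{gl}_{n,\mathfrak{o}}\to\mathbb{A}^n_{\mathfrak{o}}$ be the morphism sending a matrix to the coefficients $(c_1,\dots,c_n)$ of its characteristic polynomial, and $\rho_n$ its generic fiber. Let $\omega_{\mathfrak{gl}}$, $\omega_{\mathbb{A}}$ be translation-invariant top-degree forms on $\mathfrak{gl}_{n,F}$, $\mathbb{A}^n_F$ normalized so that $\mathfrak{gl}_n(\mathfrak{o})$ and $\mathbb{A}^n(\mathfrak{o})$ have volume $1$. For $\gamma$ regular semisimple the fiber $G_\gamma=\rho_n^{-1}(\chi_\gamma)$ is smooth and carries the quotient form $\omega^{\mathrm{ld}}_{\chi_\gamma}=\omega_{\mathfrak{gl}}/\rho_n^*\omega_{\mathbb{A}}$ (characterized by $\rho_n^*\omega_{\mathbb{A}}\otimes\omega^{\mathrm{ld}}_{\chi_\gamma}=\omega_{\mathfrak{gl}}$ on the regular locus). The stable orbital integral is $\mathcal{SO}_\gamma=\int_{\underline{G}_\gamma(\mathfrak{o})}|\omega^{\mathrm{ld}}_{\chi_\gamma}|$, where $\underline{G}_\gamma(\mathfrak{o})=\{X\in\mathfrak{gl}_n(\mathfrak{o}):\chi_X=\chi_\gamma\}$.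 For irreducible $\chi_\gamma$, $S(\gamma)$ (the Serre invariant) is the $\mathfrak{o}$-length of $\mathfrak{o}_{F_{\chi_\gamma}}/(\mathfrak{o}[x]/(\chi_\gamma(x)))$, where $\mathfrak{o}_{F_{\chi_\gamma}}$ is the ring of integers of $F_{\chi_\gamma}$. *)

theory Defs
  imports
    "HOL-Analysis.Analysis"
    "HOL-Algebra.QuotRing"
    "HOL-Algebra.Module"
    "HOL-Library.Extended_Nat"
    "Jordan_Normal_Form.Char_Poly"
begin

section \<open>Non-Archimedean local fields\<close>

text \<open>
  A non-Archimedean local field is a field that is complete with respect to a discrete
  absolute value with finite residue field; the characteristic is arbitrary.  The metric is the
  one of the normalised absolute value, the one taking the value \<open>1/q\<close> on uniformisers.  The
  residue class of \<open>x\<close> is the coset \<open>{y. |y - x| < 1}\<close> of the maximal ideal.  There are at least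
  two classes (those of 0 and 1), so \<open>1/q\<close> lies strictly between 0 and 1, and the
  axiom \<open>absv_uniformizer\<close> includes that the absolute value is nontrivial and discrete.
\<close>

class nonarch_local_field = field + complete_space +
  fixes absv :: "'a \<Rightarrow> real"
  assumes dist_absv: "dist x y = absv (x - y)"
    and absv_mult: "absv (x * y) = absv x * absv y"
    and absv_ultrametric: "absv (x + y) \<le> max (absv x) (absv y)"
    and finite_residue_classes: "finite ((\<lambda>x. {y. absv (y - x) < 1}) ` {x. absv x \<le> 1})"
    and absv_uniformizer:
      "\<exists>\<pi>. absv \<pi> = 1 / real (card ((\<lambda>x. {y. absv (y - x) < 1}) ` {x. absv x \<le> 1})) \<and>
           (\<forall>x. absv x < 1 \<longrightarrow> absv x \<le> absv \<pi>)"

definition integers :: "'a::nonarch_local_field set" where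
  "integers = {x. absv x \<le> 1}"

definition max_ideal :: "'a::nonarch_local_field set" where
  "max_ideal = {x. absv x < 1}"

definition residue_card :: "'a::nonarch_local_field itself \<Rightarrow> nat" where
  "residue_card _ = card ((\<lambda>x::'a. {y. absv (y - x) < 1}) ` integers)"

definition normalized_haar :: "'a::nonarch_local_field measure \<Rightarrow> bool" where
  "normalized_haar \<mu> \<longleftrightarrow>
     sets \<mu> = sets borel \<and>
     (\<forall>a. \<forall>A \<in> sets \<mu>. emeasure \<mu> ((\<lambda>x. a + x) ` A) = emeasure \<mu> A) \<and>
     emeasure \<mu> integers = 1"


section \<open>The measure of the quotient form on the fibres of the characteristic polynomial map\<close>

text \<open>The \<open>F\<close>-points of the fibre of \<open>\<rho>\<^sub>n\<close> over the monic polynomial \<open>f\<close>.\<close>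

definition fiber :: "nat \<Rightarrow> 'a::comm_ring_1 poly \<Rightarrow> 'a mat set" where
  "fiber n f = {X \<in> carrier_mat n n. char_poly X = f}"

definition integral_fiber :: "nat \<Rightarrow> 'a::nonarch_local_field poly \<Rightarrow> 'a mat set" where
  "integral_fiber n f = {X \<in> fiber n f. elements_mat X \<subseteq> integers}"

definition matrix_indices :: "nat \<Rightarrow> (nat \<times> nat) list" where
  "matrix_indices n = List.product [0..<n] [0..<n]"

text \<open>
  Differential 1-forms on \<open>gl\<^sub>n\<close> at a point are represented by their coefficient vectors with
  respect to the coordinate differentials \<open>dx\<^bsub>ij\<^esub>\<close>, in the order of \<open>matrix_indices\<close>.
  The partial derivative of \<open>c\<^sub>k\<close>, the coefficient of \<open>x\<^bsup>n-k\<^esup>\<close> in the characteristic polynomial,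
  in the direction of the coordinate \<open>p\<close> is the coefficient of \<open>\<epsilon>\<close> in \<open>c\<^sub>k (X + \<epsilon> E\<^sub>p)\<close>,
  a polynomial in \<open>\<epsilon>\<close>.
\<close>

definition partial_charpoly_coeff ::
    "nat \<Rightarrow> nat \<Rightarrow> nat \<times> nat \<Rightarrow> 'a::comm_ring_1 mat \<Rightarrow> 'a" where
  "partial_charpoly_coeff n k p X =
     poly.coeff (poly.coeff
       (char_poly (Matrix.mat n n (\<lambda>ij. [: X $$ ij, if ij = p then 1 else 0 :]))) (n - k)) 1"

definition d_charpoly_coeff :: "nat \<Rightarrow> nat \<Rightarrow> 'a::comm_ring_1 mat \<Rightarrow> 'a Matrix.vec" where
  "d_charpoly_coeff n k X =
     Matrix.vec (n * n) (\<lambda>l. partial_charpoly_coeff n k (matrix_indices n ! l) X)"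

definition d_coordinate :: "nat \<Rightarrow> nat \<times> nat \<Rightarrow> 'a::comm_ring_1 Matrix.vec" where
  "d_coordinate n p = Matrix.vec (n * n) (\<lambda>l. if matrix_indices n ! l = p then 1 else 0)"

text \<open>
  The function \<open>h\<close> with
  \<open>dc\<^sub>1 \<and> \<dots> \<and> dc\<^sub>n \<and> dx\<^bsub>p1\<^esub> \<and> \<dots> \<and> dx\<^bsub>pd\<^esub> = h \<omega>\<^bsub>gl\<^esub>\<close>, where \<open>ps = [p1, \<dots>, pd]\<close>,
  \<open>d = n\<^sup>2 - n\<close> and \<open>\<omega>\<^bsub>gl\<^esub>\<close> is the wedge product of all \<open>dx\<^bsub>ij\<^esub>\<close>.  Where \<open>h\<close> does not vanish,
  the entries at the positions \<open>ps\<close> are local coordinates on the fibre, and the quotient form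
  \<open>\<omega>\<^bsup>ld\<^esup>\<close>, characterised by \<open>\<rho>\<^sub>n\<^sup>* (dc\<^sub>1 \<and> \<dots> \<and> dc\<^sub>n) \<and> \<omega>\<^bsup>ld\<^esup> = \<omega>\<^bsub>gl\<^esub>\<close>, equals
  \<open>h\<^bsup>-1\<^esup> dx\<^bsub>p1\<^esub> \<and> \<dots> \<and> dx\<^bsub>pd\<^esub>\<close> in these coordinates.  The normalised invariant forms are unique
  up to units of the ring of integers, which do not affect absolute values.
\<close>

definition wedge_coeff :: "nat \<Rightarrow> (nat \<times> nat) list \<Rightarrow> 'a::comm_ring_1 mat \<Rightarrow> 'a" where
  "wedge_coeff n ps X = Determinant.det (mat_of_rows (n * n)
     (map (\<lambda>k. d_charpoly_coeff n k X) [1..<n + 1] @ map (d_coordinate n) ps))"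

definition coordinates :: "(nat \<times> nat) list \<Rightarrow> 'a mat \<Rightarrow> nat \<times> nat \<Rightarrow> 'a" where
  "coordinates ps X = restrict (\<lambda>p. X $$ p) (set ps)"

definition fiber_borel :: "nat \<Rightarrow> 'a::nonarch_local_field poly \<Rightarrow> 'a mat measure" where
  "fiber_borel n f = vimage_algebra (fiber n f) (coordinates (matrix_indices n))
     (\<Pi>\<^sub>M p \<in> set (matrix_indices n). borel)"

text \<open>
  The measure \<open>|\<omega>\<^bsup>ld\<^esup>|\<close> on the \<open>F\<close>-points of the fibre over a separable polynomial \<open>f\<close>, in the
  sense of Weil: a form that is \<open>g dx\<^bsub>p1\<^esub> \<and> \<dots> \<and> dx\<^bsub>pd\<^esub>\<close> in local coordinates induces there the
  measure \<open>|g|\<close> times the product Haar measure.  As the domains of the coordinate systems \<open>ps\<close>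
  cover the fibre, this determines the measure.
\<close>

definition quotient_form_measure ::
    "nat \<Rightarrow> 'a::nonarch_local_field poly \<Rightarrow> 'a measure \<Rightarrow> 'a mat measure \<Rightarrow> bool" where
  "quotient_form_measure n f \<mu> \<nu> \<longleftrightarrow>
     space \<nu> = fiber n f \<and> sets \<nu> = sets (fiber_borel n f) \<and>
     (\<forall>ps W. distinct ps \<and> set ps \<subseteq> set (matrix_indices n) \<and> length ps = n * n - n \<and>
        W \<in> sets \<nu> \<and> (\<forall>X \<in> W. wedge_coeff n ps X \<noteq> 0) \<and> inj_on (coordinates ps) W \<longrightarrow>
        emeasure \<nu> W =
          (\<integral>\<^sup>+ z. ennreal (1 / absv (wedge_coeff n ps (inv_into W (coordinates ps) z))) *
                 indicator (coordinates ps ` W) z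
           \<partial>(\<Pi>\<^sub>M p \<in> set ps. \<mu>)))"

text \<open>Here \<open>\<nu>\<close> is the measure \<open>|\<omega>\<^bsup>ld\<^esup>|\<close> on the fibre through \<open>\<gamma>\<close>.\<close>

definition stable_orbital_integral ::
    "'a::nonarch_local_field mat measure \<Rightarrow> 'a mat \<Rightarrow> ennreal" where
  "stable_orbital_integral \<nu> \<gamma> = emeasure \<nu> (integral_fiber (dim_row \<gamma>) (char_poly \<gamma>))"


section \<open>The extension defined by a polynomial, its ring of integers and the Serre invariant\<close>

definition ring_on :: "'a::comm_ring_1 set \<Rightarrow> 'a ring" where
  "ring_on S = \<lparr>carrier = S, mult = (*), one = 1, zero = 0, add = (+)\<rparr>"

definition ext_ring :: "'a::field poly \<Rightarrow> 'a poly set ring" where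
  "ext_ring f = ring_on UNIV Quot (cgenideal (ring_on UNIV) f)"

definition ext_class :: "'a::field poly \<Rightarrow> 'a poly \<Rightarrow> 'a poly set" where
  "ext_class f g = cgenideal (ring_on UNIV) f +>\<^bsub>ring_on UNIV\<^esub> g"

abbreviation ext_const :: "'a::field poly \<Rightarrow> 'a \<Rightarrow> 'a poly set" where
  "ext_const f a \<equiv> ext_class f [:a:]"

text \<open>The ring of integers is the integral closure of the ring of integers of the base field.\<close>

definition ext_integers :: "'a::nonarch_local_field poly \<Rightarrow> 'a poly set set" where
  "ext_integers f = {z \<in> carrier (ext_ring f).
     \<exists>p :: 'a poly. Polynomial.lead_coeff p = 1 \<and> range (poly.coeff p) \<subseteq> integers \<and>
       (\<Oplus>\<^bsub>ext_ring f\<^esub> i \<in> {..Polynomial.degree p}.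
          ext_const f (poly.coeff p i) \<otimes>\<^bsub>ext_ring f\<^esub> (z [^]\<^bsub>ext_ring f\<^esub> i)) = \<zero>\<^bsub>ext_ring f\<^esub>}"

text \<open>
  The extension is unramified iff the maximal ideal of the base generates the maximal ideal of its
  ring of integers.  The residue fields are finite, so the residue extension is always separable.
\<close>

definition unramified :: "'a::nonarch_local_field poly \<Rightarrow> bool" where
  "unramified f \<longleftrightarrow>
     (let R = (ext_ring f)\<lparr>carrier := ext_integers f\<rparr>
      in maximalideal (genideal R (ext_const f ` max_ideal)) R)"

text \<open>For monic \<open>f\<close> with coefficients in the ring of integers \<open>O\<close>, the image
  of \<open>O[x]/(f)\<close> in \<open>F[x]/(f)\<close>, to which it is isomorphic.\<close>

definition ext_order :: "'a::nonarch_local_field poly \<Rightarrow> 'a poly set set" where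
  "ext_order f = ext_class f ` {g. range (poly.coeff g) \<subseteq> integers}"

definition ext_integers_module ::
    "'a::nonarch_local_field poly \<Rightarrow> ('a, 'a poly set) module" where
  "ext_integers_module f =
     \<lparr>carrier = ext_integers f, mult = mult (ext_ring f), one = one (ext_ring f),
      zero = zero (ext_ring f), add = add (ext_ring f),
      smult = (\<lambda>a z. ext_const f a \<otimes>\<^bsub>ext_ring f\<^esub> z)\<rparr>"

text \<open>
  The record type of modules extends that of rings; the fields \<open>mult\<close> and \<open>one\<close> are irrelevant
  for a module.
\<close>

definition quotient_module ::
    "('a, 'b, 'c) module_scheme \<Rightarrow> 'b set \<Rightarrow> ('a, 'b set) module" where
  "quotient_module M N =
     \<lparr>carrier = a_rcosets\<^bsub>M\<^esub> N, mult = (\<lambda>_ _. N), one = N, zero = N, add = set_add M,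
      smult = (\<lambda>a C. \<Union>x\<in>C. N +>\<^bsub>M\<^esub> (a \<odot>\<^bsub>M\<^esub> x))\<rparr>"

definition module_length ::
    "('a, 'c) ring_scheme \<Rightarrow> ('a, 'b, 'd) module_scheme \<Rightarrow> enat" where
  "module_length R M =
     Sup {enat k | k. \<exists>C :: nat \<Rightarrow> 'b set.
            (\<forall>i\<le>k. submodule (C i) R M) \<and> (\<forall>i<k. C i \<subset> C (Suc i))}"

definition serre_invariant :: "'a::nonarch_local_field mat \<Rightarrow> nat" where
  "serre_invariant \<gamma> =
     the_enat (module_length (ring_on (integers :: 'a set))
       (quotient_module (ext_integers_module (char_poly \<gamma>)) (ext_order (char_poly \<gamma>))))"

end

theory Submission
  imports Defs "HOL-Algebra.Subrings"
begin

text \<open>The value and the derivative of the polynomial are therefore tracked together, and the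
  discriminant enters only through f'(a)^2 - 4 f(a). The lower bound 1/q for the values of g is the
  pivot of the rest. It makes the order maximal because the norm of x + y \<beta>, with \<beta> a
  root of g, is y^2 g(-x/y): outside the order norms are at least as large as the coordinates, so
  inverses lie inside it, and such a valuation ring is integrally closed. It also ends the sum over
  \<open>k\<close> at 2 s + 1. The absence of roots of f has a second use, besides excluding Hensel
  lifts: the entry \<open>b\<close> of an integral matrix in the fibre cannot vanish, so a single
  chart carries the whole measure. The density 1/|b| cancels the factor q^-k in the measure of the
  sphere |b| = q^-k, which leaves the constant 1 - 1/q in every term.\<close>

text \<open>
  Write the characteristic polynomial as \<open>f(x) = \<pi>\<^sup>2\<^sup>s g((x - a0) / \<pi>\<^sup>s)\<close> with \<open>a0\<close> integral, \<open>g\<close> monic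
  and integral, and \<open>s\<close> maximal; \<open>s\<close> is bounded because the discriminant of \<open>f\<close> does not vanish.
  By Hensel's lemma, \<open>g\<close> then takes only values of absolute value \<open>1\<close> or \<open>1/q\<close> on \<open>O\<close>.  Hence
  \<open>O[y]/(g)\<close> is the maximal order, so that \<open>S(\<gamma>) = s\<close>, and the extension is unramified iff all the
  values of \<open>g\<close> on \<open>O\<close> are units.

  An integral matrix in the fibre is determined by its first row \<open>(a, b)\<close>, which ranges over the pairs
  with \<open>|f(a)| \<le> |b| \<le> 1\<close>, and the quotient form is \<open>da db / b\<close> up to sign.  Splitting by the
  value \<open>|b| = q\<^sup>-\<^sup>k\<close> turns the orbital integral into \<open>1 - 1/q\<close> times the sum over \<open>k\<close> of the volumes of
  the sets \<open>{a \<in> O. |f(a)| \<le> q\<^sup>-\<^sup>k}\<close>.  These are balls of radius \<open>q\<^sup>-\<^sup>m\<close>, where \<open>m\<close> is \<open>k/2\<close> rounded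
  up, for \<open>k \<le> 2 s\<close>, and also for \<open>k = 2 s + 1\<close> in the ramified case; all further ones are empty.
\<close>

section \<open>The absolute value\<close>

lemma absv_nonneg [simp]: "absv x \<ge> 0" for x :: "'a::nonarch_local_field"
  using zero_le_dist[of x 0] by (simp add: dist_absv)

lemma absv_zero [simp]: "absv (0::'a::nonarch_local_field) = 0"
  using dist_absv[of "0::'a" 0] by simp

lemma absv_eq_0_iff [simp]: "absv x = 0 \<longleftrightarrow> x = 0" for x :: "'a::nonarch_local_field"
  using dist_eq_0_iff[of x 0] by (simp add: dist_absv)

lemma absv_pos_iff [simp]: "absv x > 0 \<longleftrightarrow> x \<noteq> 0" for x :: "'a::nonarch_local_field"
  using absv_nonneg[of x] absv_eq_0_iff[of x] by linarith

lemma absv_one [simp]: "absv (1::'a::nonarch_local_field) = 1"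
  using absv_mult[of "1::'a" 1] by (simp del: absv_eq_0_iff add: absv_eq_0_iff[of "1::'a"])

lemma absv_minus [simp]: "absv (- x) = absv x" for x :: "'a::nonarch_local_field"
  using dist_commute[of 0 x] by (simp add: dist_absv)

lemma absv_minus_commute: "absv (x - y) = absv (y - x)" for x :: "'a::nonarch_local_field"
  using dist_commute[of x y] by (simp add: dist_absv)

lemma absv_power: "absv (x ^ n) = absv x ^ n" for x :: "'a::nonarch_local_field"
  by (induction n) (simp_all add: absv_mult)

lemma absv_divide: "absv (x / y) = absv x / absv y" for x :: "'a::nonarch_local_field"
proof (cases "y = 0")
  case False
  then show ?thesis using absv_mult[of "x / y" y] by (simp add: field_simps)
qed simp

lemma absv_add_le: "absv x \<le> r \<Longrightarrow> absv y \<le> r \<Longrightarrow> absv (x + y) \<le> r"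
  for x :: "'a::nonarch_local_field"
  using absv_ultrametric[of x y] by linarith

lemma absv_diff_le: "absv x \<le> r \<Longrightarrow> absv y \<le> r \<Longrightarrow> absv (x - y) \<le> r"
  for x :: "'a::nonarch_local_field"
  using absv_add_le[of x r "- y"] by simp

lemma absv_add_less: "absv x < r \<Longrightarrow> absv y < r \<Longrightarrow> absv (x + y) < r"
  for x :: "'a::nonarch_local_field"
  using absv_ultrametric[of x y] by linarith

lemma absv_diff_less: "absv x < r \<Longrightarrow> absv y < r \<Longrightarrow> absv (x - y) < r"
  for x :: "'a::nonarch_local_field"
  using absv_add_less[of x r "- y"] by simp

lemma absv_add_dominant: "absv y < absv x \<Longrightarrow> absv (x + y) = absv x"
  for x :: "'a::nonarch_local_field"
  using absv_ultrametric[of x y] absv_ultrametric[of "x + y" "- y"] by auto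

lemma absv_numeral_two_le: "absv (2::'a::nonarch_local_field) \<le> 1"
  using absv_add_le[of "1::'a" 1 1] by simp

lemma absv_mult_le_one: "absv x \<le> 1 \<Longrightarrow> absv y \<le> 1 \<Longrightarrow> absv (x * y) \<le> 1"
  for x :: "'a::nonarch_local_field"
  by (simp add: absv_mult mult_le_one)

lemma absv_mult_le: "absv x \<le> 1 \<Longrightarrow> absv y \<le> r \<Longrightarrow> absv (x * y) \<le> r"
  for x :: "'a::nonarch_local_field"
  using mult_mono[of "absv x" 1 "absv y" r] by (simp add: absv_mult)

lemma absv_mult_less: "absv x \<le> 1 \<Longrightarrow> absv y < r \<Longrightarrow> absv (x * y) < r"
  for x :: "'a::nonarch_local_field"
  using absv_mult_le[of x y "absv y"] by simp

section \<open>Residue classes, the uniformizer and the value group\<close>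

lemma residue_classes_finite: "finite ((\<lambda>x::'a::nonarch_local_field. {y. absv (y - x) < 1}) ` integers)"
  using finite_residue_classes by (simp add: integers_def)

lemma residue_card_ge_2: "residue_card TYPE('a::nonarch_local_field) \<ge> 2"
proof -
  let ?c = "\<lambda>x::'a. {y. absv (y - x) < 1}"
  have "0 \<in> ?c 0" "0 \<notin> ?c 1" by simp_all
  then have "?c 0 \<noteq> ?c 1" by blast
  moreover have "{?c 0, ?c 1} \<subseteq> ?c ` integers"
    unfolding insert_subset by (intro conjI imageI) (simp_all add: integers_def)
  ultimately show ?thesis
    using card_mono[OF residue_classes_finite, of "{?c 0, ?c 1}"] by (simp add: residue_card_def)
qed

definition uniformizer :: "'a::nonarch_local_field" where
  "uniformizer = (SOME \<pi>::'a. absv \<pi> = 1 / real (residue_card TYPE('a)) \<and>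
     (\<forall>x::'a. absv x < 1 \<longrightarrow> absv x \<le> absv \<pi>))"

lemma absv_uniformizer_eq: "absv (uniformizer::'a::nonarch_local_field) = 1 / real (residue_card TYPE('a))"
  and absv_less_one_le: "\<And>x::'a. absv x < 1 \<Longrightarrow> absv x \<le> absv (uniformizer::'a)"
proof -
  have "\<exists>\<pi>::'a. absv \<pi> = 1 / real (residue_card TYPE('a)) \<and> (\<forall>x::'a. absv x < 1 \<longrightarrow> absv x \<le> absv \<pi>)"
    using absv_uniformizer by (simp add: residue_card_def integers_def)
  from someI_ex[OF this, folded uniformizer_def]
  show "absv (uniformizer::'a) = 1 / real (residue_card TYPE('a))"
    "\<And>x::'a. absv x < 1 \<Longrightarrow> absv x \<le> absv (uniformizer::'a)" by blast+
qed

lemma absv_uniformizer_less_one: "absv (uniformizer::'a::nonarch_local_field) < 1"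
  using residue_card_ge_2[where 'a='a] by (simp add: absv_uniformizer_eq)

lemma uniformizer_nonzero [simp]: "(uniformizer::'a::nonarch_local_field) \<noteq> 0"
  using residue_card_ge_2[where 'a='a] absv_uniformizer_eq[where 'a='a] by force

lemma uniformizer_integral: "absv (uniformizer ^ n :: 'a::nonarch_local_field) \<le> 1"
  using absv_uniformizer_less_one[where 'a='a] by (simp add: absv_power power_le_one)

text \<open>If \<pi>^(m+1) is the first power of \<pi> smaller than \<open>x\<close>, then x /
  \<pi>^m has absolute value above |\<pi>| and at most 1. No value lies strictly between |\<pi>| and
  1, so it is 1.\<close>

lemma absv_cases:
  fixes x :: "'a::nonarch_local_field"
  assumes "x \<noteq> 0" "absv x \<le> 1"
  obtains k where "absv x = absv (uniformizer ^ k :: 'a)"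
proof -
  let ?r = "absv (uniformizer::'a)"
  obtain n where n: "?r ^ n < absv x"
    using real_arch_pow_inv[of "absv x" ?r] assms(1) absv_uniformizer_less_one[where 'a='a] by auto
  define k where "k = (LEAST n. ?r ^ n < absv x)"
  have k: "?r ^ k < absv x" unfolding k_def by (rule LeastI[of _ n]) (rule n)
  have "k \<noteq> 0" using k assms(2) by (cases k) auto
  then obtain m where m: "k = Suc m" by (cases k) auto
  then have le: "absv x \<le> ?r ^ m"
    using not_less_Least[of m "\<lambda>n. ?r ^ n < absv x"] by (simp add: k_def not_less)
  have p: "?r ^ m > 0" by simp
  have "absv (x / uniformizer ^ m) = 1"
  proof (rule ccontr)
    assume "absv (x / uniformizer ^ m) \<noteq> 1"
    with le p have "absv (x / uniformizer ^ m) < 1"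
      by (simp add: absv_divide absv_power)
    from absv_less_one_le[OF this] p have "absv x \<le> ?r * ?r ^ m"
      by (simp add: absv_divide absv_power divide_le_eq)
    with k m show False by simp
  qed
  with p have "absv x = ?r ^ m" by (simp add: absv_divide absv_power)
  with that[of m] show ?thesis by (simp add: absv_power)
qed

text \<open>Newton's iteration with the derivative frozen at \<open>y\<close> contracts the residue
  class of \<open>y\<close>: \<phi> z - \<phi> w carries the factor (y - z) + (y - w), of absolute
  value at most |\<pi>|. Its fixed points are the roots.\<close>

lemma hensel_quadratic:
  fixes b c y :: "'a::nonarch_local_field"
  assumes "absv b \<le> 1" "absv y \<le> 1"
    and small: "absv (y\<^sup>2 + b * y + c) < 1" and simple: "absv (2 * y + b) = 1"
  obtains z where "z\<^sup>2 + b * z + c = 0"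
proof -
  let ?d = "2 * y + b" and ?r = "absv (uniformizer::'a)"
  let ?S = "cball y ?r"
  define \<phi> where "\<phi> z = z - (z\<^sup>2 + b * z + c) / ?d" for z
  have d: "?d \<noteq> 0" using simple by force
  \<comment> \<open>Values below 1 are at most |\<pi>|, so this closed, hence complete, ball is the
    whole residue class of \<open>y\<close>.\<close>
  have S: "z \<in> ?S \<longleftrightarrow> absv (z - y) < 1" for z
    using absv_less_one_le[of "z - y"] absv_uniformizer_less_one[where 'a='a]
    by (auto simp: dist_absv absv_minus_commute)
  have \<phi>: "\<phi> z - \<phi> w = (z - w) * ((y - z) + (y - w)) / ?d" for z w
  proof -
    have "\<phi> z - \<phi> w = ((z - w) * ?d - ((z\<^sup>2 + b * z + c) - (w\<^sup>2 + b * w + c))) / ?d"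
      using d by (simp add: \<phi>_def diff_divide_distrib add_divide_distrib)
    also have "(z - w) * ?d - ((z\<^sup>2 + b * z + c) - (w\<^sup>2 + b * w + c)) = (z - w) * ((y - z) + (y - w))"
      by (simp add: algebra_simps power2_eq_square)
    finally show ?thesis .
  qed
  have into: "\<phi> z \<in> ?S" if "z \<in> ?S" for z
  proof -
    have "\<phi> z - y = (\<phi> z - \<phi> y) - (y\<^sup>2 + b * y + c) / ?d"
      by (simp add: \<phi>_def)
    moreover have "absv (\<phi> z - \<phi> y) < 1"
    proof -
      have "absv (y - z) < 1" "absv (z - y) < 1"
        using that S absv_minus_commute by metis+
      then show ?thesis
        unfolding \<phi> by (simp add: absv_divide simple absv_mult_less)
    qed
    moreover have "absv ((y\<^sup>2 + b * y + c) / ?d) < 1"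
      by (simp add: absv_divide simple small)
    ultimately show ?thesis by (simp only: S absv_diff_less)
  qed
  have "\<exists>!z\<in>?S. \<phi> z = z"
  proof (rule Banach_fix[of ?S ?r])
    show "complete ?S" by (simp add: complete_eq_closed)
    show "?S \<noteq> {}" by (simp add: not_less)
    fix z w assume zw: "z \<in> ?S" "w \<in> ?S"
    have "absv ((y - z) + (y - w)) \<le> ?r"
      using zw by (intro absv_add_le) (simp_all add: dist_absv)
    then show "dist (\<phi> z) (\<phi> w) \<le> ?r * dist z w"
      using mult_right_mono[of _ ?r "absv (z - w)"]
      unfolding dist_absv \<phi> absv_divide absv_mult simple by (simp add: mult.commute[of "absv (z - w)"])
  qed (use into absv_uniformizer_less_one[where 'a='a] in auto)
  then obtain z where "\<phi> z = z" by blast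
  then have "z\<^sup>2 + b * z + c = 0" using d by (simp add: \<phi>_def)
  then show ?thesis by (rule that)
qed


section \<open>Haar measure of balls and spheres\<close>

lemma cball_integers: "cball 0 1 = (integers :: 'a::nonarch_local_field set)"
  by (auto simp: integers_def dist_absv)

locale normalized_haar_measure =
  fixes \<mu> :: "'a::nonarch_local_field measure"
  assumes haar: "normalized_haar \<mu>"
begin

lemma sets_haar [measurable_cong]: "sets \<mu> = sets borel"
  using haar by (simp add: normalized_haar_def)

lemma cball_measurable [simp]: "cball a r \<in> sets \<mu>"
  by (simp add: sets_haar)

lemma emeasure_cball_translate: "emeasure \<mu> (cball a r) = emeasure \<mu> (cball 0 r)"
proof -
  have "cball a r = (\<lambda>x. a + x) ` cball 0 r"
  proof (intro Set.set_eqI iffI)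
    fix x assume "x \<in> cball a r"
    then have "x - a \<in> cball 0 r" by (simp add: dist_absv absv_minus_commute)
    then show "x \<in> (\<lambda>x. a + x) ` cball 0 r" by (rule rev_image_eqI) simp
  qed (auto simp: dist_absv)
  with haar show ?thesis by (simp add: normalized_haar_def)
qed

text \<open>Translation invariance alone gives the scaling: multiplied by \<open>c\<close>, the q
  residue classes become q disjoint translates of the smaller ball. Small \<open>c\<close> serves
  the balls inside O, large \<open>c\<close> the exhaustion of F.\<close>

lemma emeasure_cball_split:
  fixes c :: 'a
  assumes c: "c \<noteq> 0"
  shows "emeasure \<mu> (cball 0 (absv c)) =
    of_nat (residue_card TYPE('a)) * emeasure \<mu> (cball 0 (absv (c * uniformizer)))"
proof -
  let ?C = "(\<lambda>x::'a. {y. absv (y - x) < 1}) ` integers"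
  define A where "A K = {z. z / c \<in> K}" for K :: "'a set"
  have A: "\<exists>x. absv x \<le> 1 \<and> A K = cball (c * x) (absv (c * uniformizer))" if K: "K \<in> ?C" for K
  proof -
    obtain x where x: "absv x \<le> 1" "K = {y. absv (y - x) < 1}" using K by (auto simp: integers_def)
    have "z / c \<in> K \<longleftrightarrow> dist (c * x) z \<le> absv (c * uniformizer)" for z
    proof -
      have "dist (c * x) z = absv (c * (z / c - x))"
        using c by (simp add: dist_absv absv_minus_commute right_diff_distrib)
      then show ?thesis
        using c absv_less_one_le[of "z / c - x"] absv_uniformizer_less_one[where 'a='a]
        by (auto simp: x(2) absv_mult)
    qed
    then have "A K = cball (c * x) (absv (c * uniformizer))" by (simp add: A_def cball_def)
    with x(1) show ?thesis by blast
  qed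
  have meas: "A K \<in> sets \<mu>"
    and A_emeasure: "emeasure \<mu> (A K) = emeasure \<mu> (cball 0 (absv (c * uniformizer)))"
    if K: "K \<in> ?C" for K
    using A[OF K] emeasure_cball_translate by auto
  have union: "(cball 0 (absv c) :: 'a set) = (\<Union>K\<in>?C. A K)"
  proof (intro Set.set_eqI iffI)
    fix z :: 'a assume "z \<in> cball 0 (absv c)"
    then have "absv (z / c) \<le> 1" using c by (simp add: dist_absv absv_divide)
    then have "{y. absv (y - z / c) < 1} \<in> ?C" by (auto simp: integers_def)
    moreover have "z \<in> A {y. absv (y - z / c) < 1}" by (simp add: A_def)
    ultimately show "z \<in> (\<Union>K\<in>?C. A K)" by blast
  next
    fix z assume "z \<in> (\<Union>K\<in>?C. A K)"
    then obtain x where "absv x \<le> 1" "absv (z / c - x) < 1" by (auto simp: A_def integers_def)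
    then have "absv (z / c) \<le> 1" using absv_add_le[of "z / c - x" 1 x] by simp
    then show "z \<in> cball 0 (absv c)" using c by (simp add: dist_absv absv_divide)
  qed
  have disj: "disjoint_family_on A ?C"
  proof (unfold disjoint_family_on_def, intro ballI impI)
    fix K L assume K: "K \<in> ?C" and L: "L \<in> ?C" and ne: "K \<noteq> L"
    obtain x y where x: "K = {z. absv (z - x) < 1}" and y: "L = {z. absv (z - y) < 1}"
      using K L by auto
    have False if "z \<in> K" "z \<in> L" for z
    proof -
      have "absv (x - y) < 1"
        using that absv_diff_less[of "z - y" 1 "z - x"] by (simp add: x y)
      then have "absv (w - x) < 1 \<longleftrightarrow> absv (w - y) < 1" for w
        using absv_add_less[of "w - x" 1 "x - y"] absv_diff_less[of "w - y" 1 "x - y"] by auto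
      with ne show False by (simp add: x y)
    qed
    then show "A K \<inter> A L = {}" by (auto simp: A_def)
  qed
  have "emeasure \<mu> (\<Union>K\<in>?C. A K) = (\<Sum>K\<in>?C. emeasure \<mu> (A K))"
    using meas by (intro sum_emeasure[symmetric] disj residue_classes_finite image_subsetI)
  also have "\<dots> = (\<Sum>K\<in>?C. emeasure \<mu> (cball 0 (absv (c * uniformizer))))"
    using A_emeasure by (rule sum.cong[OF refl])
  also have "\<dots> = of_nat (residue_card TYPE('a)) * emeasure \<mu> (cball 0 (absv (c * uniformizer)))"
    by (simp add: residue_card_def)
  finally show ?thesis by (simp add: union)
qed

lemma emeasure_cball_one: "emeasure \<mu> (cball 0 1) = 1"
  using haar by (simp add: normalized_haar_def cball_integers)

lemma emeasure_cball: "emeasure \<mu> (cball a (absv (uniformizer ^ k :: 'a))) = ennreal (absv (uniformizer ^ k :: 'a))"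
proof (induction k arbitrary: a)
  case 0
  then show ?case by (simp add: emeasure_cball_translate[of a] emeasure_cball_one)
next
  case (Suc k)
  let ?q = "real (residue_card TYPE('a))" and ?u = "uniformizer :: 'a"
  have q: "?q > 0" using residue_card_ge_2[where 'a='a] by simp
  let ?m = "emeasure \<mu> (cball 0 (absv (?u ^ Suc k)))"
  have "ennreal (absv (?u ^ k)) = ennreal ?q * ?m"
    using Suc.IH[of 0] emeasure_cball_split[of "?u ^ k"] by (simp add: ennreal_of_nat_eq_real_of_nat mult.commute)
  then have "ennreal (1 / ?q) * ennreal (absv (?u ^ k)) = (ennreal (1 / ?q) * ennreal ?q) * ?m"
    by (simp add: mult.assoc)
  also have "ennreal (1 / ?q) * ennreal ?q = 1"
    using q by (simp flip: ennreal_mult)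
  finally have "?m = ennreal (1 / ?q) * ennreal (absv (?u ^ k))"
    by simp
  also have "\<dots> = ennreal (absv (?u ^ Suc k))"
    by (simp add: absv_mult absv_uniformizer_eq flip: ennreal_mult)
  finally show ?case
    by (simp only: emeasure_cball_translate[of a])
qed

lemma emeasure_cball_large: "emeasure \<mu> (cball 0 (real (residue_card TYPE('a)) ^ n)) < \<infinity>"
proof (induction n)
  case 0
  then show ?case by (simp add: emeasure_cball_one)
next
  case (Suc n)
  let ?q = "real (residue_card TYPE('a))" and ?u = "uniformizer :: 'a"
  have q: "?q > 0" using residue_card_ge_2[where 'a='a] by simp
  have "absv (1 / ?u ^ Suc n) = ?q ^ Suc n" "absv (1 / ?u ^ Suc n * ?u) = ?q ^ n"
    using q by (simp_all add: absv_mult absv_divide absv_power absv_uniformizer_eq power_divide)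
  with emeasure_cball_split[of "1 / ?u ^ Suc n"] Suc show ?case
    by (simp add: ennreal_mult_less_top ennreal_of_nat_eq_real_of_nat)
qed

text \<open>Required for product measures in the chart. The balls of radius q^n exhaust F and have
  finite measure, since repeated splitting leads down to O.\<close>

lemma sigma_finite_haar: "sigma_finite_measure \<mu>"
proof
  let ?q = "real (residue_card TYPE('a))"
  have q: "?q > 1" using residue_card_ge_2[where 'a='a] by simp
  let ?A = "range (\<lambda>n. cball (0::'a) (?q ^ n))"
  have "\<Union>?A = space \<mu>"
  proof -
    have "\<exists>n. x \<in> cball 0 (?q ^ n)" for x :: 'a
      using real_arch_pow[OF q, of "absv x"] by (auto simp: dist_absv intro: less_imp_le)
    then have "\<Union>?A = UNIV" by blast
    then show ?thesis using sets_eq_imp_space_eq[OF sets_haar] by simp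
  qed
  moreover have "?A \<subseteq> sets \<mu>" by auto
  moreover have "\<forall>a\<in>?A. emeasure \<mu> a \<noteq> \<infinity>"
  proof
    fix a assume "a \<in> ?A"
    then obtain n where "a = cball 0 (?q ^ n)" by (rule rangeE)
    then show "emeasure \<mu> a \<noteq> \<infinity>" by (simp only: less_imp_neq[OF emeasure_cball_large] not_False_eq_True)
  qed
  ultimately show "\<exists>A. countable A \<and> A \<subseteq> sets \<mu> \<and> \<Union>A = space \<mu> \<and> (\<forall>a\<in>A. emeasure \<mu> a \<noteq> \<infinity>)"
    by (intro exI[of _ ?A] conjI countable_image countableI_type)
qed

lemma absv_sphere_eq:
  "{x::'a. absv x = absv (uniformizer ^ k :: 'a)} =
    cball 0 (absv (uniformizer ^ k :: 'a)) - cball 0 (absv (uniformizer ^ Suc k :: 'a))"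
proof -
  let ?u = "uniformizer :: 'a"
  have "absv x = absv (?u ^ k) \<longleftrightarrow> absv x \<le> absv (?u ^ k) \<and> \<not> absv x \<le> absv (?u ^ Suc k)" for x :: 'a
  proof -
    have "absv x < absv (?u ^ k) \<longleftrightarrow> absv x \<le> absv (?u ^ Suc k)"
    proof
      assume "absv x < absv (?u ^ k)"
      then have "absv (x / ?u ^ k) < 1" by (simp add: absv_divide)
      from absv_less_one_le[OF this] show "absv x \<le> absv (?u ^ Suc k)"
        by (simp add: absv_divide absv_mult divide_le_eq)
    next
      have "absv (?u ^ Suc k) < absv (?u ^ k)"
        using absv_uniformizer_less_one[where 'a='a] by (simp add: absv_mult)
      then show "absv x < absv (?u ^ k)" if "absv x \<le> absv (?u ^ Suc k)" using that by linarith
    qed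
    then show ?thesis by linarith
  qed
  then show ?thesis
    by (intro Set.set_eqI) (simp only: mem_Collect_eq Diff_iff mem_cball dist_absv diff_0 absv_minus)
qed

lemma emeasure_sphere:
  "emeasure \<mu> {x. absv x = absv (uniformizer ^ k :: 'a)} =
    ennreal (absv (uniformizer ^ k :: 'a) * (1 - 1 / real (residue_card TYPE('a))))"
proof -
  let ?u = "uniformizer :: 'a"
  have le: "absv (?u ^ Suc k) \<le> absv (?u ^ k)"
    using absv_uniformizer_less_one[where 'a='a] by (simp add: absv_mult mult_left_le_one_le)
  have "emeasure \<mu> {x. absv x = absv (?u ^ k)} = ennreal (absv (?u ^ k)) - ennreal (absv (?u ^ Suc k))"
    unfolding absv_sphere_eq using le
    by (subst emeasure_Diff) (simp_all only: emeasure_cball cball_measurable subset_cball infinity_ennreal_def ennreal_neq_top not_False_eq_True)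
  also have "\<dots> = ennreal (absv (?u ^ k) - absv (?u ^ Suc k))"
    by (rule ennreal_minus) simp
  finally show ?thesis
    by (simp add: absv_mult absv_uniformizer_eq algebra_simps)
qed

lemma sphere_measurable: "{x. absv x = absv (uniformizer ^ k :: 'a)} \<in> sets \<mu>"
  unfolding absv_sphere_eq by (intro sets.Diff cball_measurable)

end


section \<open>Reduction of an integral quadratic polynomial\<close>

lemma absv_uniformizer_power_le_iff:
  "absv (uniformizer ^ i :: 'a::nonarch_local_field) \<le> absv (uniformizer ^ j :: 'a) \<longleftrightarrow> j \<le> i"
  using absv_uniformizer_less_one[where 'a='a] by (simp add: absv_power)

lemma absv_uniformizer_power_less_iff:
  "absv (uniformizer ^ i :: 'a::nonarch_local_field) < absv (uniformizer ^ j :: 'a) \<longleftrightarrow> j < i"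
  using absv_uniformizer_less_one[where 'a='a] by (simp add: absv_power)

text \<open>
  The last assumption says that no substitution \<open>y \<mapsto> y\<^sub>0 + \<pi> y\<close> makes the polynomial
  divisible by \<open>\<pi>\<^sup>2\<close>; equivalently, \<open>O[y]/(y\<^sup>2 + b y + c)\<close> is integrally closed.
\<close>

locale reduced_quadratic =
  fixes b c :: "'a::nonarch_local_field"
  assumes b_integral: "absv b \<le> 1" and c_integral: "absv c \<le> 1"
    and no_root: "y\<^sup>2 + b * y + c \<noteq> 0"
    and reduced: "absv y \<le> 1 \<Longrightarrow> absv (2 * y + b) < 1 \<Longrightarrow>
      absv (y\<^sup>2 + b * y + c) > absv (uniformizer ^ 2 :: 'a)"
begin

lemma value_integral: "absv y \<le> 1 \<Longrightarrow> absv (y\<^sup>2 + b * y + c) \<le> 1"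
  by (intro absv_add_le absv_mult_le_one b_integral c_integral)
    (simp_all add: power2_eq_square absv_mult_le_one)

text \<open>A unit derivative would let Hensel's lemma lift \<open>y\<close> to a root, against
  \<open>no_root\<close>.\<close>

lemma derivative_small:
  assumes "absv y \<le> 1" "absv (y\<^sup>2 + b * y + c) < 1"
  shows "absv (2 * y + b) < 1"
proof (rule ccontr)
  assume "\<not> absv (2 * y + b) < 1"
  moreover have "absv (2 * y + b) \<le> 1"
    by (intro absv_add_le absv_mult_le_one b_integral absv_numeral_two_le assms(1))
  ultimately have "absv (2 * y + b) = 1" by simp
  from hensel_quadratic[OF b_integral assms this] no_root show False by blast
qed

lemma value_cases:
  assumes y: "absv y \<le> 1"
  shows "absv (y\<^sup>2 + b * y + c) = 1 \<or> absv (y\<^sup>2 + b * y + c) = absv (uniformizer :: 'a)"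
proof (cases "absv (y\<^sup>2 + b * y + c) < 1")
  case True
  have gt: "absv (y\<^sup>2 + b * y + c) > absv (uniformizer ^ 2 :: 'a)"
    by (intro reduced y derivative_small True)
  obtain k where k: "absv (y\<^sup>2 + b * y + c) = absv (uniformizer ^ k :: 'a)"
    using absv_cases[OF no_root value_integral[OF y]] .
  have "k < 2" using gt unfolding k absv_uniformizer_power_less_iff .
  moreover have "k \<noteq> 0" using True unfolding k by (cases k) simp_all
  ultimately have "k = 1" by simp
  with k show ?thesis by simp
qed (use value_integral[OF y] in simp)

lemma value_lower_bound: "absv y \<le> 1 \<Longrightarrow> absv (uniformizer :: 'a) \<le> absv (y\<^sup>2 + b * y + c)"
  using value_cases[of y] absv_uniformizer_less_one[where 'a='a] by auto

text \<open>Value and derivative at \<open>y\<close> are both small, so modulo \<pi> the polynomial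
  is the square (z - y)^2: the residue class of \<open>y\<close> is its only root.\<close>

lemma value_small_iff:
  assumes y: "absv y \<le> 1" "absv (y\<^sup>2 + b * y + c) < 1" and z: "absv z \<le> 1"
  shows "absv (z\<^sup>2 + b * z + c) < 1 \<longleftrightarrow> absv (z - y) < 1"
proof -
  let ?t = "z - y"
  have eq: "z\<^sup>2 + b * z + c = ?t\<^sup>2 + ((2 * y + b) * ?t + (y\<^sup>2 + b * y + c))"
    by (simp add: algebra_simps power2_eq_square)
  have t: "absv ?t \<le> 1" by (rule absv_diff_le[OF z y(1)])
  have rest: "absv ((2 * y + b) * ?t + (y\<^sup>2 + b * y + c)) < 1"
    using absv_mult_less[OF t derivative_small[OF y]] y(2)
    unfolding mult.commute[of "2 * y + b"] by (rule absv_add_less)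
  show ?thesis
  proof
    assume "absv (z\<^sup>2 + b * z + c) < 1"
    from absv_diff_less[OF this rest] have "absv (?t\<^sup>2) < 1"
      unfolding eq by (simp only: add_diff_cancel_right')
    then show "absv ?t < 1" using t by (cases "absv ?t = 1") (simp_all add: absv_power)
  next
    assume lt: "absv ?t < 1"
    have "absv (?t\<^sup>2) < 1" using absv_mult_less[OF t lt] by (simp add: power2_eq_square)
    then show "absv (z\<^sup>2 + b * z + c) < 1" unfolding eq using rest by (rule absv_add_less)
  qed
qed

end

text \<open>The substitution is a = a0 + \<pi>^s y. That \<open>s\<close> cannot be enlarged is
  encoded in \<open>reduced\<close>, a condition on \<open>b\<close> and \<open>c\<close>
  alone.\<close>

locale quadratic_reduction = reduced_quadratic b c for b c :: "'a::nonarch_local_field" +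
  fixes a0 :: 'a and s :: nat
  assumes a0_integral: "absv a0 \<le> 1"
begin

text \<open>The value f(a) of the characteristic polynomial (\<open>qpoly\<close> below), expanded
  around \<open>a0\<close>.\<close>

definition quad :: "'a \<Rightarrow> 'a" where
  "quad a = (a - a0)\<^sup>2 + b * uniformizer ^ s * (a - a0) + c * uniformizer ^ (2 * s)"

lemma quad_scaled: "quad (a0 + uniformizer ^ s * y) = uniformizer ^ (2 * s) * (y\<^sup>2 + b * y + c)"
  unfolding quad_def power_even_eq by (simp add: algebra_simps power2_eq_square)

definition sublevel :: "nat \<Rightarrow> 'a set" where
  "sublevel j = {a. absv a \<le> 1 \<and> absv (quad a) \<le> absv (uniformizer ^ j :: 'a)}"

text \<open>Let m be j/2 rounded up, so that m \<le> s. If |a - a0| \<le> |\<pi>^m|, each of the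
  three terms of \<open>quad a\<close> is at most |\<pi>^j|. Otherwise the square dominates and is
  too large.\<close>

lemma sublevel_low:
  assumes j: "j \<le> 2 * s"
  shows "sublevel j = cball a0 (absv (uniformizer ^ ((j + 1) div 2) :: 'a))"
proof -
  let ?u = "uniformizer :: 'a"
  define m where "m = (j + 1) div 2"
  have m: "m \<le> s" "j \<le> 2 * m" "2 * m \<le> j + 1" using j by (auto simp: m_def)
  have "absv a \<le> 1 \<and> absv (quad a) \<le> absv (?u ^ j) \<longleftrightarrow> absv (a - a0) \<le> absv (?u ^ m)" for a
  proof
    let ?t = "a - a0"
    assume t: "absv ?t \<le> absv (?u ^ m)"
    have "absv ?t \<le> 1" using t uniformizer_integral[of m, where 'a='a] by linarith
    then have a: "absv a \<le> 1" using absv_add_le[of ?t 1 a0] a0_integral by simp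
    have "absv ?t ^ 2 \<le> absv (?u ^ m) ^ 2" using t by (intro power_mono) simp_all
    also have "\<dots> = absv (?u ^ (2 * m))" by (simp add: absv_power mult.commute flip: power_mult)
    also have "\<dots> \<le> absv (?u ^ j)" unfolding absv_uniformizer_power_le_iff by (rule m)
    finally have 1: "absv (?t\<^sup>2) \<le> absv (?u ^ j)" by (simp add: absv_power)
    have "absv (?u ^ s * ?t) \<le> absv (?u ^ s) * absv (?u ^ m)"
      using t by (simp add: absv_mult mult_left_mono)
    also have "\<dots> = absv (?u ^ (s + m))" by (simp add: absv_mult power_add)
    also have "\<dots> \<le> absv (?u ^ j)" unfolding absv_uniformizer_power_le_iff using m by simp
    finally have 2: "absv (b * uniformizer ^ s * ?t) \<le> absv (?u ^ j)"
      unfolding mult.assoc by (rule absv_mult_le[OF b_integral])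
    have 3: "absv (c * ?u ^ (2 * s)) \<le> absv (?u ^ j)"
      using j by (intro absv_mult_le[OF c_integral]) (simp only: absv_uniformizer_power_le_iff)
    have "absv (quad a) \<le> absv (?u ^ j)"
      unfolding quad_def by (intro absv_add_le 1 2 3)
    with a show "absv a \<le> 1 \<and> absv (quad a) \<le> absv (?u ^ j)" ..
  next
    let ?t = "a - a0"
    assume a: "absv a \<le> 1 \<and> absv (quad a) \<le> absv (?u ^ j)"
    show "absv ?t \<le> absv (?u ^ m)"
    proof (rule ccontr)
      assume "\<not> absv ?t \<le> absv (?u ^ m)"
      then have t: "absv (?u ^ m) < absv ?t" by simp
      then have t0: "?t \<noteq> 0" by (metis absv_nonneg absv_zero not_le)
      have "absv ?t \<le> 1" using a a0_integral by (intro absv_diff_le) simp_all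
      from absv_cases[OF t0 this] obtain k where k: "absv ?t = absv (?u ^ k)" .
      have km: "k < m" using t unfolding k absv_uniformizer_power_less_iff .
      have sq: "absv (?t\<^sup>2) = absv (?u ^ (2 * k))"
        using k by (simp add: absv_power mult.commute flip: power_mult)
      have "absv (?u ^ s * ?t) = absv (?u ^ (s + k))" using k by (simp add: absv_mult power_add)
      also have "\<dots> < absv (?u ^ (2 * k))" unfolding absv_uniformizer_power_less_iff using km m by simp
      finally have 1: "absv (b * ?u ^ s * ?t) < absv (?t\<^sup>2)"
        unfolding sq mult.assoc by (rule absv_mult_less[OF b_integral])
      have 2: "absv (c * ?u ^ (2 * s)) < absv (?t\<^sup>2)"
        unfolding sq using km m by (intro absv_mult_less[OF c_integral]) (simp only: absv_uniformizer_power_less_iff)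
      \<comment> \<open>With |a - a0| = |\<pi>^k| and k < m \<le> s, the other terms are bounded by
        |\<pi>^(s+k)| and |\<pi>^(2s)|, both below |\<pi>^(2k)|.\<close>
      have "absv (quad a) = absv (?t\<^sup>2)"
        unfolding quad_def add.assoc by (intro absv_add_dominant absv_add_less 1 2)
      with a sq have "absv (?u ^ (2 * k)) \<le> absv (?u ^ j)" by simp
      then have "j \<le> 2 * k" unfolding absv_uniformizer_power_le_iff .
      with km m show False by linarith
    qed
  qed
  then show ?thesis
    unfolding sublevel_def m_def[symmetric]
    by (intro Set.set_eqI) (simp only: mem_Collect_eq mem_cball dist_absv absv_minus_commute[of a0])
qed

text \<open>From 2 s on, the set lies in the ball of radius |\<pi>^s| around \<open>a0\<close>,
  where the coordinate y = (a - a0) / \<pi>^s is integral and the factor \<pi>^(2s) can be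
  cancelled.\<close>

lemma sublevel_high:
  "a \<in> sublevel (2 * s + k) \<longleftrightarrow>
    (\<exists>y. absv y \<le> 1 \<and> a = a0 + uniformizer ^ s * y \<and> absv (y\<^sup>2 + b * y + c) \<le> absv (uniformizer ^ k :: 'a))"
proof -
  let ?u = "uniformizer :: 'a"
  have scaled: "absv (quad (a0 + ?u ^ s * y)) \<le> absv (?u ^ (2 * s + k)) \<longleftrightarrow>
      absv (y\<^sup>2 + b * y + c) \<le> absv (?u ^ k)" for y
    unfolding quad_scaled power_add absv_mult by simp
  show ?thesis
  proof
    assume a: "a \<in> sublevel (2 * s + k)"
    have "absv (?u ^ (2 * s + k)) \<le> absv (?u ^ (2 * s))" unfolding absv_uniformizer_power_le_iff by simp
    with a have "a \<in> sublevel (2 * s)" unfolding sublevel_def by auto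
    then have "absv (a - a0) \<le> absv (?u ^ s)"
      by (simp add: sublevel_low dist_absv absv_minus_commute)
    then have "absv ((a - a0) / ?u ^ s) \<le> 1" by (simp add: absv_divide divide_le_eq)
    moreover have eq: "a = a0 + ?u ^ s * ((a - a0) / ?u ^ s)" by simp
    moreover have "absv (((a - a0) / ?u ^ s)\<^sup>2 + b * ((a - a0) / ?u ^ s) + c) \<le> absv (?u ^ k)"
      unfolding scaled[symmetric] eq[symmetric] using a by (simp add: sublevel_def)
    ultimately show "\<exists>y. absv y \<le> 1 \<and> a = a0 + ?u ^ s * y \<and> absv (y\<^sup>2 + b * y + c) \<le> absv (?u ^ k)"
      by blast
  next
    assume "\<exists>y. absv y \<le> 1 \<and> a = a0 + ?u ^ s * y \<and> absv (y\<^sup>2 + b * y + c) \<le> absv (?u ^ k)"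
    then obtain y where y: "absv y \<le> 1" "a = a0 + ?u ^ s * y" "absv (y\<^sup>2 + b * y + c) \<le> absv (?u ^ k)"
      by blast
    have "absv (a0 + ?u ^ s * y) \<le> 1"
      by (intro absv_add_le a0_integral absv_mult_le_one uniformizer_integral y(1))
    with y(3) show "a \<in> sublevel (2 * s + k)"
      unfolding sublevel_def y(2) mem_Collect_eq scaled by (intro conjI)
  qed
qed

lemma sublevel_empty: "sublevel (2 * s + Suc (Suc k)) = {}"
proof -
  let ?u = "uniformizer :: 'a"
  have "absv (?u ^ Suc (Suc k)) < absv (?u ^ 1)" unfolding absv_uniformizer_power_less_iff by simp
  then have "\<not> absv (y\<^sup>2 + b * y + c) \<le> absv (?u ^ Suc (Suc k))" if "absv y \<le> 1" for y
    using value_lower_bound[OF that] by simp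
  then show ?thesis using sublevel_high by blast
qed

lemma sublevel_inert:
  assumes "\<And>y. absv y \<le> 1 \<Longrightarrow> absv (y\<^sup>2 + b * y + c) = 1"
  shows "sublevel (2 * s + 1) = {}"
  using assms sublevel_high[of _ 1] absv_uniformizer_less_one[where 'a='a] by auto

text \<open>In the coordinate \<open>y\<close> the condition is that the value be a nonunit, which
  by \<open>value_small_iff\<close> singles out one residue class.\<close>

lemma sublevel_ramified:
  assumes y: "absv y \<le> 1" "absv (y\<^sup>2 + b * y + c) < 1"
  shows "sublevel (2 * s + 1) = cball (a0 + uniformizer ^ s * y) (absv (uniformizer ^ (s + 1) :: 'a))"
proof -
  let ?u = "uniformizer :: 'a"
  have less: "absv x \<le> absv ?u \<longleftrightarrow> absv x < 1" for x :: 'a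
    using absv_less_one_le[of x] absv_uniformizer_less_one[where 'a='a] by linarith
  show ?thesis
  proof (intro Set.set_eqI iffI)
    fix a assume "a \<in> sublevel (2 * s + 1)"
    then obtain z where z: "absv z \<le> 1" "a = a0 + ?u ^ s * z" "absv (z\<^sup>2 + b * z + c) \<le> absv (?u ^ 1)"
      using sublevel_high[of a 1] by blast
    then have "absv (z - y) \<le> absv ?u" unfolding less using value_small_iff[OF y z(1)] by (simp add: less)
    then have "absv (?u ^ s * (z - y)) \<le> absv (?u ^ (s + 1))"
      by (simp add: absv_mult mult_right_mono mult.commute)
    then show "a \<in> cball (a0 + ?u ^ s * y) (absv (?u ^ (s + 1)))"
      unfolding mem_cball dist_absv absv_minus_commute[of _ a] unfolding z(2) by (simp add: right_diff_distrib)
  next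
    fix a assume a: "a \<in> cball (a0 + ?u ^ s * y) (absv (?u ^ (s + 1)))"
    define z where "z = (a - a0) / ?u ^ s"
    have az: "a = a0 + ?u ^ s * z" by (simp add: z_def)
    have "absv (?u ^ s * (z - y)) \<le> absv (?u ^ (s + 1))"
      using a unfolding mem_cball dist_absv absv_minus_commute[of _ a] unfolding az by (simp add: right_diff_distrib)
    then have zy: "absv (z - y) < 1" unfolding less[symmetric] by (simp add: absv_mult)
    then have z: "absv z \<le> 1" using absv_add_le[of "z - y" 1 y] y(1) by simp
    have "absv (z\<^sup>2 + b * z + c) \<le> absv (?u ^ 1)"
      using zy value_small_iff[OF y z] by (simp add: less)
    with z az show "a \<in> sublevel (2 * s + 1)" using sublevel_high[of a 1] by blast
  qed
qed

end

theorem quadratic_reduction_exists: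
  fixes u w :: "'a::nonarch_local_field"
  assumes integral: "absv u \<le> 1" "absv w \<le> 1"
    and no_root: "\<And>z. z\<^sup>2 + u * z + w \<noteq> 0" and disc: "u\<^sup>2 - 4 * w \<noteq> 0"
  obtains b c a0 s where "quadratic_reduction b c a0"
    "u = b * uniformizer ^ s - 2 * a0"
    "w = a0\<^sup>2 - b * uniformizer ^ s * a0 + c * uniformizer ^ (2 * s)"
proof -
  let ?u = "uniformizer :: 'a"
  \<comment> \<open>f(a + \<pi>^t y) = \<pi>^(2t) y^2 + \<pi>^t f'(a) y + f(a), so
    \<open>P t a\<close> says that this is \<pi>^(2t) times a monic integral polynomial in
    y.\<close>
  define P where "P t a \<longleftrightarrow> absv a \<le> 1 \<and> absv (2 * a + u) \<le> absv (?u ^ t) \<and>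
    absv (a\<^sup>2 + u * a + w) \<le> absv (?u ^ (2 * t))" for t a
  obtain N where N: "absv ?u ^ N < absv (u\<^sup>2 - 4 * w)"
    using real_arch_pow_inv[of "absv (u\<^sup>2 - 4 * w)" "absv ?u"] disc absv_uniformizer_less_one[where 'a='a]
    by auto
  \<comment> \<open>For every \<open>a\<close> the discriminant equals (2 a + u)^2 - 4 f(a), hence
    is divisible by \<pi>^(2t). This yields 2 t < N; mere boundedness suffices for choosing a
    maximal \<open>s\<close>.\<close>
  have bound: "t \<le> N" if "P t a" for t a
  proof -
    have "absv (2 * a + u) ^ 2 \<le> absv (?u ^ t) ^ 2"
      using that by (intro power_mono) (simp_all add: P_def)
    then have 1: "absv ((2 * a + u)\<^sup>2) \<le> absv (?u ^ (2 * t))"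
      by (simp add: absv_power mult.commute flip: power_mult)
    have four: "absv (2 * 2 :: 'a) \<le> 1" by (intro absv_mult_le_one absv_numeral_two_le)
    have 2: "absv ((2 * 2) * (a\<^sup>2 + u * a + w)) \<le> absv (?u ^ (2 * t))"
      by (rule absv_mult_le[OF four]) (use that in \<open>simp only: P_def\<close>)
    have "u\<^sup>2 - 4 * w = (2 * a + u)\<^sup>2 - (2 * 2) * (a\<^sup>2 + u * a + w)"
      by (simp add: algebra_simps power2_eq_square)
    with absv_diff_le[OF 1 2] N have "absv (?u ^ N) < absv (?u ^ (2 * t))"
      by (simp add: absv_power)
    then show ?thesis unfolding absv_uniformizer_power_less_iff by simp
  qed
  have "P 0 0" using integral by (simp add: P_def)
  then have "\<exists>s. (\<exists>a. P s a) \<and> (\<forall>t. (\<exists>a. P t a) \<longrightarrow> t \<le> s)"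
    using bound by (intro ex_has_greatest_nat[of _ 0 "\<lambda>t. t" "Suc N"]) (auto simp: less_Suc_eq_le)
  then obtain s a0 where P: "P s a0" and max: "\<And>t a. P t a \<Longrightarrow> t \<le> s" by blast
  define b where "b = (2 * a0 + u) / ?u ^ s"
  define c where "c = (a0\<^sup>2 + u * a0 + w) / ?u ^ (2 * s)"
  have u_eq: "u = b * ?u ^ s - 2 * a0" by (simp add: b_def)
  have w_eq: "w = a0\<^sup>2 - b * ?u ^ s * a0 + c * ?u ^ (2 * s)"
  proof -
    have "b * ?u ^ s = 2 * a0 + u" "c * ?u ^ (2 * s) = a0\<^sup>2 + u * a0 + w"
      by (simp_all add: b_def c_def)
    then show ?thesis by (simp add: algebra_simps power2_eq_square)
  qed
  have scaled: "(a0 + ?u ^ s * y)\<^sup>2 + u * (a0 + ?u ^ s * y) + w = ?u ^ (2 * s) * (y\<^sup>2 + b * y + c)" for y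
    unfolding u_eq w_eq power_even_eq by (simp add: algebra_simps power2_eq_square)
  have scaled': "2 * (a0 + ?u ^ s * y) + u = ?u ^ s * (2 * y + b)" for y
    unfolding u_eq by (simp add: algebra_simps)
  have "quadratic_reduction b c a0"
  proof
    show "absv b \<le> 1" "absv c \<le> 1" "absv a0 \<le> 1"
      using P by (simp_all add: P_def b_def c_def absv_divide divide_le_eq)
    show "y\<^sup>2 + b * y + c \<noteq> 0" for y
      using no_root[of "a0 + ?u ^ s * y"] unfolding scaled by simp
    fix y :: 'a assume y: "absv y \<le> 1" and d: "absv (2 * y + b) < 1"
    show "absv (y\<^sup>2 + b * y + c) > absv (?u ^ 2)"
    proof (rule ccontr)
      assume "\<not> absv (y\<^sup>2 + b * y + c) > absv (?u ^ 2)"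
      then have v: "absv (y\<^sup>2 + b * y + c) \<le> absv (?u ^ 2)" by simp
      \<comment> \<open>A violation of \<open>reduced\<close> at \<open>y\<close> allows recentring
        at a0 + \<pi>^s y with a larger exponent.\<close>
      have "P (Suc s) (a0 + ?u ^ s * y)"
        unfolding P_def scaled scaled'
      proof (intro conjI)
        show "absv (a0 + ?u ^ s * y) \<le> 1"
          using P y by (intro absv_add_le absv_mult_le_one uniformizer_integral) (simp_all add: P_def)
        show "absv (?u ^ s * (2 * y + b)) \<le> absv (?u ^ Suc s)"
          using absv_less_one_le[OF d] by (simp add: absv_mult mult.commute mult_left_mono)
        have "absv (?u ^ (2 * s)) * absv (y\<^sup>2 + b * y + c) \<le> absv (?u ^ (2 * s)) * absv (?u ^ 2)"
          using v by (intro mult_left_mono) simp_all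
        then show "absv (?u ^ (2 * s) * (y\<^sup>2 + b * y + c)) \<le> absv (?u ^ (2 * Suc s))"
          by (simp add: absv_mult mult.assoc mult.commute power2_eq_square)
      qed
      from max[OF this] show False by simp
    qed
  qed
  from that[OF this u_eq w_eq] show ?thesis .
qed


section \<open>The extension defined by a polynomial\<close>

lemma cring_ring_on_UNIV: "cring (ring_on (UNIV :: 'b::comm_ring_1 set))"
proof (rule cringI)
  show "abelian_group (ring_on (UNIV :: 'b set))"
    by (rule abelian_groupI) (auto simp: ring_on_def algebra_simps intro: exI[of _ "- x" for x])
  show "comm_monoid (ring_on (UNIV :: 'b set))"
    by (rule comm_monoidI) (auto simp: ring_on_def algebra_simps)
qed (auto simp: ring_on_def algebra_simps)

lemma ideal_cgenideal_ring_on: "ideal (cgenideal (ring_on UNIV) f) (ring_on (UNIV :: 'b::comm_ring_1 set))"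
  by (rule cring.cgenideal_ideal[OF cring_ring_on_UNIV]) (simp add: ring_on_def)

lemma cring_ext_ring: "cring (ext_ring f)"
  unfolding ext_ring_def by (intro ideal.quotient_is_cring ideal_cgenideal_ring_on cring_ring_on_UNIV)

lemma ext_class_hom: "ext_class f \<in> Ring.ring_hom (ring_on UNIV) (ext_ring f)"
proof -
  have "ext_class f = (+>\<^bsub>ring_on UNIV\<^esub>) (cgenideal (ring_on UNIV) f)"
    by (rule ext) (simp add: ext_class_def)
  then show ?thesis
    unfolding ext_ring_def using ideal.rcos_ring_hom[OF ideal_cgenideal_ring_on] by simp
qed

lemma ext_class_eq: "ext_class f g = {p. f dvd p - g}"
proof -
  have "ext_class f g = {x * f + g | x. True}"
    by (auto simp: ext_class_def a_r_coset_def' cgenideal_def ring_on_def)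
  also have "\<dots> = {p. f dvd p - g}"
    by (auto simp: dvd_def algebra_simps)
  finally show ?thesis .
qed

lemma ext_class_eq_iff: "ext_class f g = ext_class f h \<longleftrightarrow> f dvd g - h"
proof
  assume "ext_class f g = ext_class f h"
  then have "g \<in> ext_class f h" by (auto simp: ext_class_eq)
  then show "f dvd g - h" by (simp add: ext_class_eq)
next
  assume gh: "f dvd g - h"
  have "f dvd p - g \<longleftrightarrow> f dvd p - h" for p
    using dvd_add[OF _ gh, of "p - g"] dvd_diff[OF _ gh, of "p - h"] by auto
  then show "ext_class f g = ext_class f h" by (simp add: ext_class_eq)
qed

lemma carrier_ext_ring: "carrier (ext_ring f) = range (ext_class f)"
  by (auto simp: ext_ring_def FactRing_def A_RCOSETS_def' ext_class_def ring_on_def)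

lemma ext_class_mult: "ext_class f g \<otimes>\<^bsub>ext_ring f\<^esub> ext_class f h = ext_class f (g * h)"
  using ring_hom_mult[OF ext_class_hom, of g h f] by (simp add: ring_on_def)

lemma ext_class_add: "ext_class f g \<oplus>\<^bsub>ext_ring f\<^esub> ext_class f h = ext_class f (g + h)"
  using ring_hom_add[OF ext_class_hom, of g h f] by (simp add: ring_on_def)

lemma ext_class_one: "\<one>\<^bsub>ext_ring f\<^esub> = ext_class f 1"
  using ring_hom_one[OF ext_class_hom, of f] by (simp add: ring_on_def)

lemma ext_class_zero: "\<zero>\<^bsub>ext_ring f\<^esub> = ext_class f 0"
proof -
  interpret E: cring "ext_ring f" by (rule cring_ext_ring)
  have "ext_class f 0 \<oplus>\<^bsub>ext_ring f\<^esub> ext_class f 0 = ext_class f 0" by (simp add: ext_class_add)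
  then show ?thesis
    by (metis E.add.r_cancel_one' carrier_ext_ring rangeI)
qed

text \<open>
  Valuation rings are integrally closed: multiplying a monic equation of degree \<open>m + 1\<close> for \<open>z\<close>
  by the \<open>m\<close>-th power of \<open>z'\<close> expresses \<open>z\<close> by elements of \<open>L\<close>.
\<close>

lemma (in cring) integral_inverse_mem:
  assumes L: "subring L R" and z: "z \<in> carrier R" and z': "z' \<in> L" and inv: "z \<otimes> z' = \<one>"
    and p: "\<And>i. p i \<in> L" and monic: "p (Suc m) = \<one>"
    and root: "(\<Oplus>i\<in>{..Suc m}. p i \<otimes> (z [^] i)) = \<zero>"
  shows "z \<in> L"
proof -
  have LR: "x \<in> L \<Longrightarrow> x \<in> carrier R" for x using subringE(1)[OF L] by blast
  note closed [simp] = LR[OF z'] LR[OF p] z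
  let ?S = "\<lambda>k. \<Oplus>i\<in>{..k}. p i \<otimes> (z [^] i)"
  have S [simp]: "?S k \<in> carrier R" for k by (intro finsum_closed) auto
  have one: "z [^] k \<otimes> z' [^] k = \<one>" for k :: nat
    by (simp add: inv flip: nat_pow_distrib)
  have step: "?S (Suc k) = p (Suc k) \<otimes> (z [^] Suc k) \<oplus> ?S k" for k
    by (intro finsum_Suc) auto
  \<comment> \<open>Passing from \<open>k\<close> to \<open>Suc k\<close> multiplies the previous
    element by z' and adds the coefficient p (k + 1), so no expansion into powers of z' is
    needed.\<close>
  have mem: "z' [^] k \<otimes> ?S k \<in> L" for k
  proof (induction k)
    case 0
    then show ?case using p by simp
  next
    case (Suc k)
    have "z' [^] Suc k \<otimes> ?S (Suc k) =
        z' [^] Suc k \<otimes> (p (Suc k) \<otimes> (z [^] Suc k)) \<oplus> z' [^] Suc k \<otimes> ?S k"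
      unfolding step by (intro r_distr) auto
    also have "z' [^] Suc k \<otimes> (p (Suc k) \<otimes> (z [^] Suc k)) = p (Suc k) \<otimes> (z [^] Suc k \<otimes> z' [^] Suc k)"
      by (simp del: nat_pow_Suc add: m_ac)
    also have "\<dots> = p (Suc k)" unfolding one by simp
    also have "z' [^] Suc k \<otimes> ?S k = z' \<otimes> (z' [^] k \<otimes> ?S k)"
      by (simp add: m_ac)
    finally show ?case
      using subringE(6,7)[OF L] z' p Suc.IH by simp
  qed
  have "\<zero> = z' [^] m \<otimes> ?S (Suc m)" unfolding root by simp
  also have "\<dots> = z' [^] m \<otimes> (p (Suc m) \<otimes> (z [^] Suc m)) \<oplus> z' [^] m \<otimes> ?S m"
    unfolding step by (intro r_distr) auto
  also have "z' [^] m \<otimes> (p (Suc m) \<otimes> (z [^] Suc m)) = z \<otimes> (z [^] m \<otimes> z' [^] m)"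
    by (simp add: monic m_ac)
  finally have "z \<oplus> z' [^] m \<otimes> ?S m = \<zero>" unfolding one by simp
  then have "z = \<ominus> (z' [^] m \<otimes> ?S m)" by (intro minus_equality[symmetric]) (simp_all add: a_comm)
  then show ?thesis by (rule ssubst) (rule subringE(5)[OF L mem])
qed

context quadratic_reduction
begin

text \<open>This is \<pi>^(2s) g((x - a0) / \<pi>^s) multiplied out, for g = y^2 + b y + c.\<close>

definition qpoly :: "'a poly" where
  "qpoly = [: a0\<^sup>2 - b * uniformizer ^ s * a0 + c * uniformizer ^ (2 * s), b * uniformizer ^ s - 2 * a0, 1 :]"

text \<open>The element \<open>x + y \<beta>\<close> for the root \<open>\<beta> = (X - a0) / \<pi>\<^sup>s\<close> of \<open>y\<^sup>2 + b y + c\<close>.\<close>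

definition elt :: "'a \<Rightarrow> 'a \<Rightarrow> 'a poly set" where
  "elt x y = ext_class qpoly [: x - y * a0 / uniformizer ^ s, y / uniformizer ^ s :]"

abbreviation E where "E \<equiv> ext_ring qpoly"

sublocale E: cring E by (rule cring_ext_ring)

lemma degree_qpoly: "Polynomial.degree qpoly = 2"
  by (simp add: qpoly_def)

lemma ext_class_linear: "ext_class qpoly [: x, y :] = elt (x + y * a0) (y * uniformizer ^ s)"
  by (simp add: elt_def)

lemma ext_class_const: "ext_const qpoly x = elt x 0"
  by (simp add: elt_def)

lemma elt_eq_iff [simp]: "elt x y = elt x' y' \<longleftrightarrow> x = x' \<and> y = y'"
proof
  assume "elt x y = elt x' y'"
  then have "qpoly dvd [: x - y * a0 / uniformizer ^ s, y / uniformizer ^ s :] -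
      [: x' - y' * a0 / uniformizer ^ s, y' / uniformizer ^ s :]" (is "_ dvd ?d")
    by (simp only: elt_def ext_class_eq_iff)
  moreover have "Polynomial.degree ?d < Polynomial.degree qpoly"
    by (simp add: degree_qpoly)
  ultimately have "?d = 0" by (metis dvd_imp_degree_le not_le)
  then show "x = x' \<and> y = y'" by auto
qed simp

lemma elt_cases:
  assumes "z \<in> carrier E"
  obtains x y where "z = elt x y"
proof -
  obtain h where h: "z = ext_class qpoly h" using assms by (auto simp: carrier_ext_ring)
  have "Polynomial.degree (h mod qpoly) < 2"
    using degree_mod_less[of qpoly h] degree_qpoly by (cases "qpoly = 0"; cases "h mod qpoly = 0") auto
  then have "poly.coeff (h mod qpoly) (Suc (Suc k)) = 0" for k
    by (intro coeff_eq_0) simp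
  then have xy: "h mod qpoly = [: poly.coeff (h mod qpoly) 0, poly.coeff (h mod qpoly) 1 :]"
    by (intro poly_eqI) (simp add: coeff_pCons split: nat.split)
  have "z = ext_class qpoly (h mod qpoly)"
    unfolding h ext_class_eq_iff by (metis dvd_minus_mod)
  with xy that show ?thesis by (metis ext_class_linear)
qed

lemma elt_closed [simp]: "elt x y \<in> carrier E"
  by (simp add: elt_def carrier_ext_ring)

lemma elt_add [simp]: "elt x y \<oplus>\<^bsub>E\<^esub> elt x' y' = elt (x + x') (y + y')"
  by (simp add: elt_def ext_class_add add_divide_distrib algebra_simps)

text \<open>This is the relation \<beta>^2 = - b \<beta> - c; on representatives the two sides
  differ by y y' / \<pi>^(2s) times \<open>qpoly\<close>.\<close>

lemma elt_mult [simp]: "elt x y \<otimes>\<^bsub>E\<^esub> elt x' y' = elt (x * x' - c * y * y') (x * y' + x' * y - b * y * y')"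
proof -
  let ?v = "uniformizer ^ s :: 'a"
  have "[: x - y * a0 / ?v, y / ?v :] * [: x' - y' * a0 / ?v, y' / ?v :] -
      [: (x * x' - c * y * y') - (x * y' + x' * y - b * y * y') * a0 / ?v, (x * y' + x' * y - b * y * y') / ?v :] =
      Polynomial.smult (y * y' / ?v\<^sup>2) qpoly"
    unfolding qpoly_def power_even_eq by (simp add: field_simps power2_eq_square)
  then show ?thesis
    unfolding elt_def ext_class_mult ext_class_eq_iff by (simp add: dvd_smult)
qed

lemma elt_one: "\<one>\<^bsub>E\<^esub> = elt 1 0"
  by (simp add: elt_def ext_class_one one_pCons)

lemma elt_zero: "\<zero>\<^bsub>E\<^esub> = elt 0 0"
  by (simp add: elt_def ext_class_zero)

lemma elt_minus [simp]: "\<ominus>\<^bsub>E\<^esub> elt x y = elt (- x) (- y)"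
  by (rule E.minus_equality) (simp_all add: elt_zero)

end


section \<open>The ring of integers of a quadratic extension\<close>

context quadratic_reduction
begin

text \<open>The field norm of x + y \<beta>. The other root of g is - b - \<beta>, so the conjugate
  is (x - b y) - y \<beta>; divided by the norm it gives the inverse.\<close>

definition elt_norm :: "'a \<Rightarrow> 'a \<Rightarrow> 'a" where
  "elt_norm x y = x\<^sup>2 - b * x * y + c * y\<^sup>2"

lemma elt_mult_inverse:
  assumes "elt_norm x y \<noteq> 0"
  shows "elt x y \<otimes>\<^bsub>E\<^esub> elt ((x - b * y) / elt_norm x y) (- y / elt_norm x y) = \<one>\<^bsub>E\<^esub>"
proof -
  let ?N = "elt_norm x y"
  have "x * ((x - b * y) / ?N) - c * y * (- y / ?N) = (x * (x - b * y) + c * y * y) / ?N"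
    by (simp add: add_divide_distrib)
  also have "x * (x - b * y) + c * y * y = ?N"
    by (simp add: elt_norm_def algebra_simps power2_eq_square)
  finally have "x * ((x - b * y) / ?N) - c * y * (- y / ?N) = ?N / ?N" .
  moreover have "x * (- y / ?N) + (x - b * y) / ?N * y - b * y * (- y / ?N) = 0"
    by (simp add: algebra_simps diff_divide_distrib)
  ultimately show ?thesis using assms unfolding elt_mult elt_one elt_eq_iff by simp
qed

lemma absv_elt_norm_fst:
  assumes xy: "absv y < absv x"
  shows "absv (elt_norm x y) = (absv x)\<^sup>2"
proof -
  have x: "absv x > 0" using xy absv_nonneg[of y] by linarith
  have "absv (x * y) < (absv x)\<^sup>2"
    using xy x by (simp add: absv_mult power2_eq_square)
  then have 1: "absv (b * x * y) < absv (x\<^sup>2)"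
    unfolding mult.assoc absv_power by (rule absv_mult_less[OF b_integral])
  have "absv (y\<^sup>2) < absv (x\<^sup>2)"
    using xy by (simp add: absv_power power_strict_mono)
  then have 2: "absv (c * y\<^sup>2) < absv (x\<^sup>2)"
    by (rule absv_mult_less[OF c_integral])
  have "elt_norm x y = x\<^sup>2 + (c * y\<^sup>2 - b * x * y)" by (simp add: elt_norm_def)
  then show ?thesis
    using absv_add_dominant[OF absv_diff_less[OF 2 1]] by (simp add: absv_power)
qed

lemma elt_norm_scaled: "y \<noteq> 0 \<Longrightarrow> elt_norm x y = y\<^sup>2 * ((- x / y)\<^sup>2 + b * (- x / y) + c)"
  by (simp add: elt_norm_def field_simps power2_eq_square)

text \<open>If \<open>x\<close> dominates, the norm has size |x|^2 > |x|. Otherwise it is at least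
  |y|^2 |\<pi>| by the lower bound for the values of g, and |y| > 1 forces |y| |\<pi>| \<ge>
  1.\<close>

lemma elt_norm_lower_bound:
  assumes "\<not> (absv x \<le> 1 \<and> absv y \<le> 1)"
  shows "elt_norm x y \<noteq> 0" "absv x \<le> absv (elt_norm x y)" "absv y \<le> absv (elt_norm x y)"
proof -
  have "absv (elt_norm x y) > 0 \<and> absv x \<le> absv (elt_norm x y) \<and> absv y \<le> absv (elt_norm x y)"
  proof (cases "absv y < absv x")
    case True
    then have "absv x > 1" using assms by linarith
    then have "absv x < (absv x)\<^sup>2"
      using mult_strict_right_mono[of 1 "absv x" "absv x"] unfolding power2_eq_square by linarith
    with True \<open>absv x > 1\<close> show ?thesis by (simp only: absv_elt_norm_fst[OF True]) linarith
  next
    case False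
    then have y: "absv y > 1" using assms by linarith
    then have y0: "y \<noteq> 0" by force
    have "absv (- x / y) \<le> 1" using False y by (simp add: absv_divide divide_le_eq)
    then have "absv (uniformizer :: 'a) \<le> absv ((- x / y)\<^sup>2 + b * (- x / y) + c)"
      by (rule value_lower_bound)
    then have "(absv y)\<^sup>2 * absv (uniformizer :: 'a) \<le> absv (elt_norm x y)"
      unfolding elt_norm_scaled[OF y0] absv_mult[of "y\<^sup>2"] absv_power by (intro mult_left_mono) simp_all
    moreover have "absv y \<le> (absv y)\<^sup>2 * absv (uniformizer :: 'a)"
    proof -
      have "absv (1 / y) < 1" using y y0 by (simp add: absv_divide divide_less_eq)
      from absv_less_one_le[OF this] have "1 \<le> absv y * absv (uniformizer :: 'a)"
        using y y0 by (simp add: absv_divide divide_le_eq mult.commute)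
      then show ?thesis using mult_left_mono[of 1 "absv y * absv (uniformizer :: 'a)" "absv y"]
        by (simp add: power2_eq_square mult.assoc)
    qed
    ultimately show ?thesis using False y by linarith
  qed
  then show "elt_norm x y \<noteq> 0" "absv x \<le> absv (elt_norm x y)" "absv y \<le> absv (elt_norm x y)"
    by auto
qed

definition maximal_order :: "'a poly set set" where
  "maximal_order = {elt x y | x y. absv x \<le> 1 \<and> absv y \<le> 1}"

lemma elt_in_maximal_order_iff [simp]: "elt x y \<in> maximal_order \<longleftrightarrow> absv x \<le> 1 \<and> absv y \<le> 1"
  by (auto simp: maximal_order_def)

lemma subring_maximal_order: "subring maximal_order E"
proof (rule E.subringI)
  show "maximal_order \<subseteq> carrier E" by (auto simp: maximal_order_def)
  show "\<one>\<^bsub>E\<^esub> \<in> maximal_order" by (simp add: elt_one)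
next
  fix z assume "z \<in> maximal_order"
  then show "\<ominus>\<^bsub>E\<^esub> z \<in> maximal_order" by (auto simp: maximal_order_def)
next
  fix z z' assume "z \<in> maximal_order" "z' \<in> maximal_order"
  then obtain x y x' y' where z: "z = elt x y" "z' = elt x' y'"
    and i: "absv x \<le> 1" "absv y \<le> 1" "absv x' \<le> 1" "absv y' \<le> 1"
    by (auto simp: maximal_order_def)
  show "z \<oplus>\<^bsub>E\<^esub> z' \<in> maximal_order" unfolding z elt_add elt_in_maximal_order_iff by (intro conjI absv_add_le i)
  show "z \<otimes>\<^bsub>E\<^esub> z' \<in> maximal_order"
    unfolding z elt_mult elt_in_maximal_order_iff
    by (intro conjI absv_add_le absv_diff_le absv_mult_le_one i b_integral c_integral)
qed

text \<open>The conjugate over the norm is integral because the norm bounds both coordinates. Thus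
  the order is a valuation ring.\<close>

lemma elt_integral_inverse:
  assumes "elt x y \<notin> maximal_order"
  obtains z where "z \<in> maximal_order" "elt x y \<otimes>\<^bsub>E\<^esub> z = \<one>\<^bsub>E\<^esub>"
proof
  let ?N = "elt_norm x y"
  have N: "?N \<noteq> 0" "absv x \<le> absv ?N" "absv y \<le> absv ?N"
    using assms elt_norm_lower_bound[of x y] by simp_all
  have "absv (x - b * y) \<le> absv ?N"
    by (intro absv_diff_le N absv_mult_le[OF b_integral])
  with N show "elt ((x - b * y) / ?N) (- y / ?N) \<in> maximal_order"
    by (simp add: absv_divide divide_le_eq)
  show "elt x y \<otimes>\<^bsub>E\<^esub> elt ((x - b * y) / ?N) (- y / ?N) = \<one>\<^bsub>E\<^esub>"
    by (rule elt_mult_inverse[OF N(1)])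
qed

theorem ext_integers_qpoly: "ext_integers qpoly = maximal_order"
proof (intro Set.set_eqI iffI)
  fix z assume "z \<in> ext_integers qpoly"
  then obtain p :: "'a poly" where z: "z \<in> carrier E" and p: "Polynomial.lead_coeff p = 1" "range (poly.coeff p) \<subseteq> integers"
    and root: "(\<Oplus>\<^bsub>E\<^esub> i \<in> {..Polynomial.degree p}. elt (poly.coeff p i) 0 \<otimes>\<^bsub>E\<^esub> (z [^]\<^bsub>E\<^esub> i)) = \<zero>\<^bsub>E\<^esub>"
    unfolding ext_integers_def ext_class_const by blast
  show "z \<in> maximal_order"
  proof (rule ccontr)
    assume nz: "z \<notin> maximal_order"
    obtain x y where xy: "z = elt x y" using elt_cases[OF z] .
    obtain z' where z': "z' \<in> maximal_order" "z \<otimes>\<^bsub>E\<^esub> z' = \<one>\<^bsub>E\<^esub>"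
      using elt_integral_inverse[of x y] nz xy by metis
    have coeff: "elt (poly.coeff p i) 0 \<in> maximal_order" for i
      using p(2) by (auto simp: integers_def)
    show False
    proof (cases "Polynomial.degree p")
      \<comment> \<open>A monic equation of degree 0 reads 1 = 0.\<close>
      case 0
      with root p(1) z show False by (simp add: elt_one[symmetric]) (simp add: elt_one elt_zero)
    next
      case (Suc m)
      have "elt (poly.coeff p (Suc m)) 0 = \<one>\<^bsub>E\<^esub>" using p(1) Suc by (simp add: elt_one)
      from E.integral_inverse_mem[OF subring_maximal_order z z' coeff this root[unfolded Suc]] nz
      show False by blast
    qed
  qed
next
  fix z assume "z \<in> maximal_order"
  then obtain x y where z: "z = elt x y" and xy: "absv x \<le> 1" "absv y \<le> 1" by (auto simp: maximal_order_def)
  \<comment> \<open>The characteristic polynomial of x + y \<beta>, whose trace is 2 x - b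
    y.\<close>
  let ?p = "[: elt_norm x y, b * y - 2 * x, 1 :]"
  have "absv (elt_norm x y) \<le> 1"
    unfolding elt_norm_def power2_eq_square
    by (intro absv_add_le absv_diff_le absv_mult_le_one xy b_integral c_integral)
  moreover have "absv (b * y - 2 * x) \<le> 1"
    by (intro absv_diff_le absv_mult_le_one xy b_integral absv_numeral_two_le)
  ultimately have "range (poly.coeff ?p) \<subseteq> integers"
    by (auto simp: integers_def coeff_pCons split: nat.split)
  moreover have "(\<Oplus>\<^bsub>E\<^esub> i \<in> {..Polynomial.degree ?p}. elt (poly.coeff ?p i) 0 \<otimes>\<^bsub>E\<^esub> (z [^]\<^bsub>E\<^esub> i)) = \<zero>\<^bsub>E\<^esub>"
    by (simp add: z elt_one elt_zero Pi_def elt_norm_def algebra_simps power2_eq_square)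
  ultimately show "z \<in> ext_integers qpoly"
    unfolding ext_integers_def ext_class_const using z by (intro CollectI conjI exI[of _ ?p]) simp_all
qed

section \<open>Ideals of the maximal order and the criterion for being unramified\<close>

abbreviation "int_ring \<equiv> E\<lparr>carrier := maximal_order\<rparr>"

lemma ring_int_ring: "ring int_ring"
  by (rule E.subring_is_ring[OF subring_maximal_order])

text \<open>Additive inverses come for free, as multiplication by -1 is multiplication by an element
  of the order; commutativity makes one-sided absorption enough.\<close>

lemma ideal_int_ringI:
  assumes "I \<subseteq> maximal_order" "I \<noteq> {}"
    and "\<And>z z'. z \<in> I \<Longrightarrow> z' \<in> I \<Longrightarrow> z \<oplus>\<^bsub>E\<^esub> z' \<in> I"
    and "\<And>z z'. z \<in> I \<Longrightarrow> z' \<in> maximal_order \<Longrightarrow> z \<otimes>\<^bsub>E\<^esub> z' \<in> I"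
  shows "ideal I int_ring"
proof -
  interpret R: ring int_ring by (rule ring_int_ring)
  have carr: "z \<in> carrier E" if "z \<in> maximal_order" for z
    using that subringE(1)[OF subring_maximal_order] by blast
  have comm: "z \<otimes>\<^bsub>E\<^esub> z' = z' \<otimes>\<^bsub>E\<^esub> z" if "z \<in> maximal_order" "z' \<in> maximal_order" for z z'
    using that carr by (intro E.m_comm)
  have neg: "\<ominus>\<^bsub>int_ring\<^esub> z \<in> I" if z: "z \<in> I" for z
  proof -
    have zl: "z \<in> maximal_order" using z assms(1) by blast
    have "\<ominus>\<^bsub>int_ring\<^esub> z = z \<otimes>\<^bsub>E\<^esub> elt (- 1) 0"
    proof (rule R.minus_equality)
      obtain x y where "z = elt x y" using zl by (auto simp: maximal_order_def)
      then show "z \<otimes>\<^bsub>E\<^esub> elt (- 1) 0 \<oplus>\<^bsub>int_ring\<^esub> z = \<zero>\<^bsub>int_ring\<^esub>" by (simp add: elt_zero)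
    qed (use zl subringE(6)[OF subring_maximal_order zl, of "elt (- 1) 0"] in simp_all)
    then show ?thesis using assms(4)[OF z, of "elt (- 1) 0"] by simp
  qed
  show ?thesis
  proof (rule idealI[OF ring_int_ring])
    show "subgroup I (add_monoid int_ring)"
      using assms(1-3) neg by (intro R.add.subgroupI) (simp_all add: a_inv_def)
  qed (use assms(1,4) comm in \<open>auto simp: subset_iff\<close>)
qed

definition uniformizer_ideal :: "'a poly set set" where
  "uniformizer_ideal = {elt x y | x y. absv x < 1 \<and> absv y < 1}"

lemma elt_in_uniformizer_ideal_iff [simp]: "elt x y \<in> uniformizer_ideal \<longleftrightarrow> absv x < 1 \<and> absv y < 1"
  by (auto simp: uniformizer_ideal_def)

lemma ideal_uniformizer_ideal: "ideal uniformizer_ideal int_ring"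
proof (rule ideal_int_ringI)
  show "uniformizer_ideal \<subseteq> maximal_order" by (auto simp: uniformizer_ideal_def)
  show "uniformizer_ideal \<noteq> {}" using elt_in_uniformizer_ideal_iff[of 0 0] by fastforce
  fix z z' assume z: "z \<in> uniformizer_ideal"
  then obtain x y where xy: "z = elt x y" "absv x < 1" "absv y < 1" by (auto simp: uniformizer_ideal_def)
  {
    assume "z' \<in> uniformizer_ideal"
    then obtain x' y' where xy': "z' = elt x' y'" "absv x' < 1" "absv y' < 1"
      by (auto simp: uniformizer_ideal_def)
    show "z \<oplus>\<^bsub>E\<^esub> z' \<in> uniformizer_ideal"
      unfolding xy(1) xy'(1) elt_add elt_in_uniformizer_ideal_iff by (intro conjI absv_add_less xy xy')
  next
    assume "z' \<in> maximal_order"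
    then obtain x' y' where xy': "z' = elt x' y'" "absv x' \<le> 1" "absv y' \<le> 1"
      by (auto simp: maximal_order_def)
    have prods: "absv (x * x') < 1" "absv (c * y * y') < 1" "absv (x * y') < 1" "absv (x' * y) < 1"
      "absv (b * y * y') < 1"
      using absv_mult_less[OF xy'(2) xy(2)] absv_mult_less[OF xy'(3) xy(2)] absv_mult_less[OF xy'(2) xy(3)]
        absv_mult_less[OF xy'(3) absv_mult_less[OF c_integral xy(3)]]
        absv_mult_less[OF xy'(3) absv_mult_less[OF b_integral xy(3)]]
      by (simp_all add: absv_mult mult_ac)
    show "z \<otimes>\<^bsub>E\<^esub> z' \<in> uniformizer_ideal"
      unfolding xy(1) xy'(1) elt_mult elt_in_uniformizer_ideal_iff
      by (intro conjI absv_add_less absv_diff_less prods)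
  }
qed

lemma genideal_max_ideal: "genideal int_ring (ext_const qpoly ` max_ideal) = uniformizer_ideal"
proof
  interpret R: ring int_ring by (rule ring_int_ring)
  show "genideal int_ring (ext_const qpoly ` max_ideal) \<subseteq> uniformizer_ideal"
    by (rule R.genideal_minimal[OF ideal_uniformizer_ideal]) (auto simp: ext_class_const max_ideal_def)
  show "uniformizer_ideal \<subseteq> genideal int_ring (ext_const qpoly ` max_ideal)"
  proof
    fix z assume "z \<in> uniformizer_ideal"
    then obtain x y where xy: "z = elt x y" "absv x < 1" "absv y < 1" by (auto simp: uniformizer_ideal_def)
    have "z \<in> I" if I: "ideal I int_ring" and sub: "ext_const qpoly ` max_ideal \<subseteq> I" for I
    proof -
      have in_I: "elt x 0 \<in> I" "elt y 0 \<in> I"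
        using xy sub by (auto simp: max_ideal_def image_subset_iff ext_class_const)
      then have "elt 0 1 \<otimes>\<^bsub>int_ring\<^esub> elt y 0 \<in> I" by (intro ideal.I_l_closed[OF I]) simp_all
      then have "elt 0 y \<in> I" by simp
      then have "elt x 0 \<oplus>\<^bsub>int_ring\<^esub> elt 0 y \<in> I"
        by (intro additive_subgroup.a_closed[OF ideal.axioms(1)[OF I]] in_I)
      then show "z \<in> I" by (simp add: xy)
    qed
    then show "z \<in> genideal int_ring (ext_const qpoly ` max_ideal)" unfolding genideal_def by blast
  qed
qed

text \<open>Modulo \<pi> the maximal order becomes \<kappa>[y]/(g), over the residue field \<kappa>.
  It is a field iff the quadratic g has no root in \<kappa>, that is, iff no value of g on O is a
  nonunit.\<close>

lemma unramified_iff: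
  "unramified qpoly \<longleftrightarrow> (\<forall>y. absv y \<le> 1 \<longrightarrow> absv (y\<^sup>2 + b * y + c) = 1)"
proof -
  have unr: "unramified qpoly \<longleftrightarrow> maximalideal uniformizer_ideal int_ring"
    unfolding unramified_def Let_def ext_integers_qpoly genideal_max_ideal ..
  show ?thesis
  proof
    assume "unramified qpoly"
    then interpret M: maximalideal uniformizer_ideal int_ring unfolding unr .
    show "\<forall>y. absv y \<le> 1 \<longrightarrow> absv (y\<^sup>2 + b * y + c) = 1"
    proof (rule ccontr)
      assume "\<not> (\<forall>y. absv y \<le> 1 \<longrightarrow> absv (y\<^sup>2 + b * y + c) = 1)"
      then obtain t where t: "absv t \<le> 1" and "absv (t\<^sup>2 + b * t + c) \<noteq> 1" by blast
      then have gt: "absv (t\<^sup>2 + b * t + c) < 1" using value_integral[OF t] by simp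
      \<comment> \<open>For a root \<open>t\<close> of g modulo \<pi>, this is the kernel of the map
        to the residue field sending \<beta> to the class of \<open>t\<close>.\<close>
      define J where "J = {elt x y | x y. absv x \<le> 1 \<and> absv y \<le> 1 \<and> absv (x + y * t) < 1}"
      have J [simp]: "elt x y \<in> J \<longleftrightarrow> absv x \<le> 1 \<and> absv y \<le> 1 \<and> absv (x + y * t) < 1" for x y
        by (auto simp: J_def)
      have "ideal J int_ring"
      proof (rule ideal_int_ringI)
        show "J \<subseteq> maximal_order" by (auto simp: J_def)
        show "J \<noteq> {}" using J[of 0 0] by fastforce
        fix z z' assume "z \<in> J"
        then obtain x y where xy: "z = elt x y" "absv x \<le> 1" "absv y \<le> 1" "absv (x + y * t) < 1"
          by (auto simp: J_def)
        {
          assume "z' \<in> J"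
          then obtain x' y' where xy': "z' = elt x' y'" "absv x' \<le> 1" "absv y' \<le> 1" "absv (x' + y' * t) < 1"
            by (auto simp: J_def)
          have "absv (x + x' + (y + y') * t) < 1"
            using absv_add_less[OF xy(4) xy'(4)] by (simp add: algebra_simps)
          then show "z \<oplus>\<^bsub>E\<^esub> z' \<in> J"
            unfolding xy(1) xy'(1) elt_add J by (intro conjI absv_add_le xy xy')
        next
          assume z': "z' \<in> maximal_order"
          then obtain x' y' where xy': "z' = elt x' y'" "absv x' \<le> 1" "absv y' \<le> 1"
            by (auto simp: maximal_order_def)
          have "z \<otimes>\<^bsub>E\<^esub> z' \<in> maximal_order"
            using subringE(6)[OF subring_maximal_order _ z', of z] xy by simp
          \<comment> \<open>Evaluation at \<open>t\<close> is multiplicative up to the error y y'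
            g(t), which is small.\<close>
          moreover have "absv ((x' + y' * t) * (x + y * t) - (y * y') * (t\<^sup>2 + b * t + c)) < 1"
            by (intro absv_diff_less absv_mult_less absv_add_le absv_mult_le_one xy xy' t gt)
          then have "absv ((x * x' - c * y * y') + (x * y' + x' * y - b * y * y') * t) < 1"
            by (simp add: algebra_simps power2_eq_square)
          ultimately show "z \<otimes>\<^bsub>E\<^esub> z' \<in> J"
            unfolding xy(1) xy'(1) elt_mult J elt_in_maximal_order_iff by blast
        }
      qed
      moreover have "uniformizer_ideal \<subseteq> J"
      proof
        fix z assume "z \<in> uniformizer_ideal"
        then obtain x y where xy: "z = elt x y" "absv x < 1" "absv y < 1" by (auto simp: uniformizer_ideal_def)
        then have "absv (x + t * y) < 1" by (intro absv_add_less absv_mult_less t)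
        with xy show "z \<in> J" by (simp add: mult.commute)
      qed
      moreover have "J \<subseteq> carrier int_ring" by (auto simp: J_def)
      ultimately have "J = uniformizer_ideal \<or> J = carrier int_ring" by (rule M.I_maximal)
      \<comment> \<open>The element \<beta> - t shows that \<open>J\<close> is strictly larger than
        the ideal of \<pi>, and 1 shows that it is proper.\<close>
      moreover have "elt (- t) 1 \<in> J" "elt (- t) 1 \<notin> uniformizer_ideal" using t by simp_all
      moreover have "elt 1 0 \<in> carrier int_ring" "elt 1 0 \<notin> J" by simp_all
      ultimately show False by blast
    qed
  next
    assume unit: "\<forall>y. absv y \<le> 1 \<longrightarrow> absv (y\<^sup>2 + b * y + c) = 1"
    show "unramified qpoly"
      unfolding unr
    proof (rule maximalidealI[OF ideal_uniformizer_ideal])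
      have "elt 1 0 \<in> carrier int_ring" "elt 1 0 \<notin> uniformizer_ideal" by simp_all
      then show "carrier int_ring \<noteq> uniformizer_ideal" by blast
      fix J assume J: "ideal J int_ring" and sub: "uniformizer_ideal \<subseteq> J" and JL: "J \<subseteq> carrier int_ring"
      show "J = uniformizer_ideal \<or> J = carrier int_ring"
      proof (cases "J = uniformizer_ideal")
        case False
        then obtain z where z: "z \<in> J" "z \<notin> uniformizer_ideal" using sub by blast
        with JL obtain x y where xy: "z = elt x y" "absv x \<le> 1" "absv y \<le> 1" by (auto simp: maximal_order_def)
        \<comment> \<open>Some coordinate of \<open>z\<close> is a unit; as all values of g are
          units, so is the norm. Hence \<open>z\<close> is invertible in the order and
          \<open>J\<close> contains 1.\<close>
        have N: "absv (elt_norm x y) = 1"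
        proof (cases "absv y < absv x")
          case True
          then have "absv x = 1" using xy z by auto
          then show ?thesis using absv_elt_norm_fst[OF True] by simp
        next
          case False
          then have y: "absv y = 1" using xy z by auto
          then have y0: "y \<noteq> 0" by force
          have "absv (- x / y) \<le> 1" using False y by (simp add: absv_divide)
          with unit have "absv ((- x / y)\<^sup>2 + b * (- x / y) + c) = 1" by blast
          then show ?thesis
            unfolding elt_norm_scaled[OF y0] absv_mult[of "y\<^sup>2"] absv_power y by simp
        qed
        then have N0: "elt_norm x y \<noteq> 0" by force
        let ?z' = "elt ((x - b * y) / elt_norm x y) (- y / elt_norm x y)"
        have "absv (x - b * y) \<le> 1" by (intro absv_diff_le absv_mult_le_one xy b_integral)
        then have "?z' \<in> carrier int_ring" using xy N by (simp add: absv_divide)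
        then have "z \<otimes>\<^bsub>int_ring\<^esub> ?z' \<in> J" using ideal.I_r_closed[OF J z(1)] by blast
        then have "\<one>\<^bsub>int_ring\<^esub> \<in> J" using elt_mult_inverse[OF N0] xy(1) by simp
        then have "J = carrier int_ring" by (rule ideal.one_imp_carrier[OF J])
        then show ?thesis ..
      qed simp
    qed
  qed
qed

end


section \<open>The Serre invariant of a quadratic extension\<close>

context quadratic_reduction
begin

text \<open>The class of X is a0 + \<pi>^s \<beta>, so O[X]/(f) is O + \<pi>^s O \<beta>.\<close>

lemma ext_order_qpoly:
  "ext_order qpoly = {elt x y | x y. absv x \<le> 1 \<and> absv y \<le> absv (uniformizer ^ s :: 'a)}"
proof (intro Set.set_eqI iffI)
  let ?u = "uniformizer ^ s :: 'a"
  fix z assume "z \<in> ext_order qpoly"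
  then obtain h where h: "z = ext_class qpoly h" "range (poly.coeff h) \<subseteq> integers"
    by (auto simp: ext_order_def)
  from h(2) have "\<exists>x y. ext_class qpoly h = elt x y \<and> absv x \<le> 1 \<and> absv y \<le> absv ?u"
  proof (induction h)
    case 0
    then show ?case by (intro exI[of _ 0]) (simp add: elt_zero flip: ext_class_zero)
  next
    case (pCons t h)
    have t: "absv t \<le> 1" using pCons.prems by (auto simp: integers_def dest: spec[of _ 0] simp: image_subset_iff)
    have "range (poly.coeff h) \<subseteq> integers"
      using pCons.prems by (auto simp: image_subset_iff) (metis coeff_pCons_Suc)
    with pCons.IH obtain x y where h: "ext_class qpoly h = elt x y" and xy: "absv x \<le> 1" "absv y \<le> absv ?u"
      by blast
    have y1: "absv y \<le> 1" using xy(2) uniformizer_integral[of s, where 'a='a] by linarith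
    have "ext_class qpoly (pCons t h) = ext_class qpoly ([: t :] + [: 0, 1 :] * h)" by simp
    \<comment> \<open>One Horner step: \<open>elt a0 ?u\<close> is the class of X.\<close>
    also have "\<dots> = elt t 0 \<oplus>\<^bsub>E\<^esub> (elt a0 ?u \<otimes>\<^bsub>E\<^esub> elt x y)"
      unfolding ext_class_add[symmetric] ext_class_mult[symmetric] h ext_class_const ext_class_linear by simp
    also have "\<dots> = elt (t + (a0 * x - c * ?u * y)) (y * a0 + x * ?u - (b * y) * ?u)"
      by (simp add: mult_ac)
    finally have "ext_class qpoly (pCons t h) = elt (t + (a0 * x - c * ?u * y)) (y * a0 + x * ?u - (b * y) * ?u)" .
    moreover have "absv (t + (a0 * x - c * ?u * y)) \<le> 1"
      by (intro absv_add_le absv_diff_le absv_mult_le_one t a0_integral c_integral xy y1 uniformizer_integral)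
    moreover have "absv (y * a0) \<le> absv ?u"
      unfolding mult.commute[of y] by (rule absv_mult_le[OF a0_integral xy(2)])
    then have "absv (y * a0 + x * ?u - (b * y) * ?u) \<le> absv ?u"
      by (intro absv_add_le absv_diff_le absv_mult_le[of _ ?u] absv_mult_le_one b_integral xy y1 order_refl)
    ultimately show ?case by blast
  qed
  with h show "z \<in> {elt x y | x y. absv x \<le> 1 \<and> absv y \<le> absv ?u}" by blast
next
  let ?u = "uniformizer ^ s :: 'a"
  fix z assume "z \<in> {elt x y | x y. absv x \<le> 1 \<and> absv y \<le> absv ?u}"
  then obtain x y where z: "z = elt x y" and xy: "absv x \<le> 1" "absv y \<le> absv ?u" by blast
  have yu: "absv (y / ?u) \<le> 1" using xy by (simp add: absv_divide divide_le_eq)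
  then have "absv (x - (y / ?u) * a0) \<le> 1"
    by (intro absv_diff_le absv_mult_le_one xy a0_integral)
  with yu have "range (poly.coeff [: x - y * a0 / ?u, y / ?u :]) \<subseteq> integers"
    by (auto simp: integers_def coeff_pCons split: nat.split)
  then show "z \<in> ext_order qpoly" unfolding z elt_def ext_order_def by blast
qed

text \<open>The coset of y \<beta> modulo O + \<pi>^s O \<beta>. The first coordinate is absorbed,
  so for integral \<open>y\<close> these cosets identify the quotient with O/\<pi>^s O.\<close>

definition order_coset :: "'a \<Rightarrow> 'a poly set set" where
  "order_coset y = {elt x y' | x y'. absv x \<le> 1 \<and> absv (y' - y) \<le> absv (uniformizer ^ s :: 'a)}"

lemma elt_in_order_coset_iff [simp]:
  "elt x y' \<in> order_coset y \<longleftrightarrow> absv x \<le> 1 \<and> absv (y' - y) \<le> absv (uniformizer ^ s :: 'a)"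
  by (auto simp: order_coset_def)

lemma order_coset_eq_iff: "order_coset y = order_coset y' \<longleftrightarrow> absv (y - y') \<le> absv (uniformizer ^ s :: 'a)"
proof
  assume "order_coset y = order_coset y'"
  moreover have "elt 0 y \<in> order_coset y" by simp
  ultimately have "elt 0 y \<in> order_coset y'" by simp
  then show "absv (y - y') \<le> absv (uniformizer ^ s :: 'a)" by simp
next
  assume yy': "absv (y - y') \<le> absv (uniformizer ^ s :: 'a)"
  have "absv (w - y) \<le> absv (uniformizer ^ s :: 'a) \<longleftrightarrow> absv (w - y') \<le> absv (uniformizer ^ s :: 'a)" for w
    using absv_add_le[OF _ yy', of "w - y"] absv_diff_le[OF _ yy', of "w - y'"] by auto
  then show "order_coset y = order_coset y'" by (simp add: order_coset_def)
qed

lemma order_coset_zero: "order_coset 0 = ext_order qpoly"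
  by (simp add: order_coset_def ext_order_qpoly)

abbreviation "serre_module \<equiv> quotient_module (ext_integers_module qpoly) (ext_order qpoly)"

lemma coset_elt:
  assumes "absv x \<le> 1"
  shows "ext_order qpoly +>\<^bsub>ext_integers_module qpoly\<^esub> elt x y = order_coset y"
proof (intro Set.set_eqI iffI)
  fix z assume "z \<in> ext_order qpoly +>\<^bsub>ext_integers_module qpoly\<^esub> elt x y"
  with assms show "z \<in> order_coset y"
    by (auto simp: a_r_coset_def' ext_integers_module_def ext_order_qpoly intro: absv_add_le)
next
  fix z assume "z \<in> order_coset y"
  then obtain x' y' where z: "z = elt x' y'" "absv x' \<le> 1" "absv (y' - y) \<le> absv (uniformizer ^ s :: 'a)"
    by (auto simp: order_coset_def)
  then have "elt (x' - x) (y' - y) \<in> ext_order qpoly"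
    using absv_diff_le[OF z(2) assms] by (auto simp: ext_order_qpoly)
  moreover have "z = elt (x' - x) (y' - y) \<oplus>\<^bsub>E\<^esub> elt x y" by (simp add: z)
  ultimately show "z \<in> ext_order qpoly +>\<^bsub>ext_integers_module qpoly\<^esub> elt x y"
    by (auto simp only: a_r_coset_def' ext_integers_module_def module.simps ring.simps partial_object.simps monoid.simps)
qed

lemma carrier_serre_module: "carrier serre_module = order_coset ` integers"
proof -
  have "carrier serre_module =
      (\<Union>z\<in>maximal_order. {ext_order qpoly +>\<^bsub>ext_integers_module qpoly\<^esub> z})"
    by (simp add: quotient_module_def A_RCOSETS_def' ext_integers_module_def ext_integers_qpoly)
  also have "\<dots> = order_coset ` integers"
    unfolding maximal_order_def integers_def using coset_elt by force
  finally show ?thesis .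
qed

lemma zero_serre_module: "\<zero>\<^bsub>serre_module\<^esub> = order_coset 0"
  by (simp add: quotient_module_def order_coset_zero)

lemma add_serre_module: "order_coset y \<oplus>\<^bsub>serre_module\<^esub> order_coset y' = order_coset (y + y')"
proof -
  let ?u = "uniformizer ^ s :: 'a"
  have "order_coset y \<oplus>\<^bsub>serre_module\<^esub> order_coset y' =
      (\<Union>z\<in>order_coset y. \<Union>z'\<in>order_coset y'. {z \<oplus>\<^bsub>E\<^esub> z'})"
    by (simp add: quotient_module_def set_add_def' ext_integers_module_def)
  also have "\<dots> = order_coset (y + y')"
  proof (intro Set.set_eqI iffI)
    fix z assume "z \<in> (\<Union>z\<in>order_coset y. \<Union>z'\<in>order_coset y'. {z \<oplus>\<^bsub>E\<^esub> z'})"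
    then obtain x1 y1 x2 y2 where z: "z = elt (x1 + x2) (y1 + y2)" and
      i: "absv x1 \<le> 1" "absv x2 \<le> 1" "absv (y1 - y) \<le> absv ?u" "absv (y2 - y') \<le> absv ?u"
      by (auto simp: order_coset_def)
    have "absv (x1 + x2) \<le> 1" by (rule absv_add_le[OF i(1,2)])
    moreover have "absv (y1 + y2 - (y + y')) \<le> absv ?u"
      using absv_add_le[OF i(3,4)] by (simp add: algebra_simps)
    ultimately show "z \<in> order_coset (y + y')" by (simp add: z)
  next
    fix z assume "z \<in> order_coset (y + y')"
    then obtain x w where z: "z = elt x w" "absv x \<le> 1" "absv (w - (y + y')) \<le> absv ?u"
      by (auto simp: order_coset_def)
    then have "elt x (w - y') \<in> order_coset y" by (simp add: algebra_simps)
    moreover have "elt 0 y' \<in> order_coset y'" by simp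
    moreover have "z = elt x (w - y') \<oplus>\<^bsub>E\<^esub> elt 0 y'" by (simp add: z)
    ultimately show "z \<in> (\<Union>z\<in>order_coset y. \<Union>z'\<in>order_coset y'. {z \<oplus>\<^bsub>E\<^esub> z'})" by blast
  qed
  finally show ?thesis .
qed

lemma smult_serre_module:
  assumes t: "absv t \<le> 1"
  shows "t \<odot>\<^bsub>serre_module\<^esub> order_coset y = order_coset (t * y)"
proof -
  let ?u = "uniformizer ^ s :: 'a"
  have "ext_order qpoly +>\<^bsub>ext_integers_module qpoly\<^esub> (elt t 0 \<otimes>\<^bsub>E\<^esub> z) = order_coset (t * y)"
    if "z \<in> order_coset y" for z
  proof -
    obtain x w where z: "z = elt x w" "absv x \<le> 1" "absv (w - y) \<le> absv ?u"
      using \<open>z \<in> order_coset y\<close> by (auto simp: order_coset_def)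
    have "absv (t * w - t * y) \<le> absv ?u"
      using absv_mult_le[OF t z(3)] by (simp add: right_diff_distrib)
    then have "order_coset (t * w) = order_coset (t * y)" by (simp add: order_coset_eq_iff)
    then show ?thesis by (simp add: z coset_elt absv_mult_le_one t)
  qed
  moreover have "elt 0 y \<in> order_coset y" by simp
  ultimately have "(\<Union>z\<in>order_coset y. ext_order qpoly +>\<^bsub>ext_integers_module qpoly\<^esub> (elt t 0 \<otimes>\<^bsub>E\<^esub> z)) =
      order_coset (t * y)" by blast
  then show ?thesis
    by (simp add: quotient_module_def ext_class_const) (simp add: ext_integers_module_def ext_class_const)
qed

text \<open>Submodules are subgroups of the additive monoid, hence closed under this inverse. It is
  evaluated straight from its defining description, without first making the quotient a
  group.\<close>

lemma inv_serre_module: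
  assumes y: "absv y \<le> 1"
  shows "inv\<^bsub>add_monoid serre_module\<^esub> order_coset y = order_coset (- y)"
  unfolding m_inv_def
proof (rule the_equality)
  show "order_coset (- y) \<in> carrier (add_monoid serre_module) \<and>
    order_coset y \<otimes>\<^bsub>add_monoid serre_module\<^esub> order_coset (- y) = \<one>\<^bsub>add_monoid serre_module\<^esub> \<and>
    order_coset (- y) \<otimes>\<^bsub>add_monoid serre_module\<^esub> order_coset y = \<one>\<^bsub>add_monoid serre_module\<^esub>"
    using y by (simp add: carrier_serre_module add_serre_module zero_serre_module integers_def)
  fix z assume "z \<in> carrier (add_monoid serre_module) \<and>
    order_coset y \<otimes>\<^bsub>add_monoid serre_module\<^esub> z = \<one>\<^bsub>add_monoid serre_module\<^esub> \<and>
    z \<otimes>\<^bsub>add_monoid serre_module\<^esub> order_coset y = \<one>\<^bsub>add_monoid serre_module\<^esub>"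
  then obtain w where "z = order_coset w" "order_coset (w + y) = order_coset 0"
    by (auto simp: carrier_serre_module add_serre_module zero_serre_module)
  then show "z = order_coset (- y)" by (simp add: order_coset_eq_iff)
qed

section \<open>Submodules of the quotient and its length\<close>

lemma submodule_order_coset:
  assumes C: "submodule C (ring_on integers) serre_module"
  shows "C \<subseteq> order_coset ` integers" "order_coset 0 \<in> C"
    "absv t \<le> 1 \<Longrightarrow> order_coset y \<in> C \<Longrightarrow> order_coset (t * y) \<in> C"
proof -
  have sub: "subgroup C (add_monoid serre_module)" by (rule submodule.axioms(1)[OF C])
  show "C \<subseteq> order_coset ` integers"
    using subgroup.subset[OF sub] by (simp add: carrier_serre_module)
  show "order_coset 0 \<in> C"
    using subgroup.one_closed[OF sub] by (simp add: zero_serre_module)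
  show "order_coset (t * y) \<in> C" if "absv t \<le> 1" "order_coset y \<in> C"
    using submodule.smult_closed[OF C, of t "order_coset y"] that smult_serre_module[of t y]
    by (simp add: ring_on_def integers_def)
qed

text \<open>Ideals of O/\<pi>^s O are generated by powers of \<pi>; the number of exponents below
  \<open>s\<close> occurring in a submodule serves as its length.\<close>

definition coset_levels :: "'a poly set set set \<Rightarrow> nat set" where
  "coset_levels C = {i. i < s \<and> order_coset (uniformizer ^ i) \<in> C}"

text \<open>A class in \<open>C'\<close> but not in \<open>C\<close> is a unit times \<pi>^i with i
  < s. Closure under units puts \<pi>^i itself in \<open>C'\<close> and keeps it out of
  \<open>C\<close>.\<close>

lemma coset_levels_strict_mono:
  assumes C: "submodule C (ring_on integers) serre_module"
    and C': "submodule C' (ring_on integers) serre_module" and less: "C \<subset> C'"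
  shows "coset_levels C \<subset> coset_levels C'"
proof -
  let ?u = "uniformizer :: 'a"
  obtain z where z: "z \<in> C'" "z \<notin> C" using less by blast
  with submodule_order_coset(1)[OF C'] obtain y where y: "z = order_coset y" "absv y \<le> 1"
    by (auto simp: integers_def)
  have nle: "\<not> absv y \<le> absv (?u ^ s)"
  proof
    assume "absv y \<le> absv (?u ^ s)"
    then have "order_coset y = order_coset 0" by (simp add: order_coset_eq_iff)
    with z(2) y(1) submodule_order_coset(2)[OF C] show False by simp
  qed
  then have y0: "y \<noteq> 0" using absv_nonneg[of "?u ^ s"] by (metis absv_zero)
  obtain i where i: "absv y = absv (?u ^ i)" using absv_cases[OF y0 y(2)] .
  have i_less: "i < s" using nle unfolding i absv_uniformizer_power_le_iff by simp
  have "order_coset ((?u ^ i / y) * y) \<in> C'"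
    using z(1) y(1) i y0 by (intro submodule_order_coset(3)[OF C']) (simp_all add: absv_divide)
  then have in': "order_coset (?u ^ i) \<in> C'" using y0 by simp
  have "order_coset (?u ^ i) \<notin> C"
  proof
    assume "order_coset (?u ^ i) \<in> C"
    then have "order_coset ((y / ?u ^ i) * ?u ^ i) \<in> C"
      using i by (intro submodule_order_coset(3)[OF C]) (simp_all add: absv_divide)
    with z(2) y(1) show False by simp
  qed
  with i_less in' have "i \<in> coset_levels C' - coset_levels C" by (simp add: coset_levels_def)
  moreover have "coset_levels C \<subseteq> coset_levels C'" using less by (auto simp: coset_levels_def)
  ultimately show ?thesis by blast
qed

lemma submodule_chain_length_le:
  assumes C: "\<And>i. i \<le> k \<Longrightarrow> submodule (C i) (ring_on integers) serre_module"
    and less: "\<And>i. i < k \<Longrightarrow> C i \<subset> C (Suc i)"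
  shows "k \<le> s"
proof -
  have fin: "finite (coset_levels D)" for D by (simp add: coset_levels_def)
  have "i \<le> k \<Longrightarrow> i \<le> card (coset_levels (C i))" for i
  proof (induction i)
    case (Suc i)
    then have "coset_levels (C i) \<subset> coset_levels (C (Suc i))"
      by (intro coset_levels_strict_mono C less) simp_all
    from psubset_card_mono[OF fin this] Suc show ?case by simp
  qed simp
  then have "k \<le> card (coset_levels (C k))" by simp
  also have "\<dots> \<le> card {..<s}" by (intro card_mono) (auto simp: coset_levels_def)
  finally show ?thesis by simp
qed

text \<open>The ascending chain \<pi>^(s-i) O / \<pi>^s O, which for i from 0 to \<open>s\<close>
  attains the bound on chains.\<close>

definition coset_filtration :: "nat \<Rightarrow> 'a poly set set set" where
  "coset_filtration i = order_coset ` {y. absv y \<le> absv (uniformizer ^ (s - i) :: 'a)}"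

lemma submodule_coset_filtration: "submodule (coset_filtration i) (ring_on integers) serre_module"
proof
  let ?u = "uniformizer ^ (s - i) :: 'a"
  have int: "absv y \<le> 1" if "absv y \<le> absv ?u" for y :: 'a
    using that uniformizer_integral[of "s - i", where 'a='a] by linarith
  show "coset_filtration i \<subseteq> carrier (add_monoid serre_module)"
    using int by (auto simp: coset_filtration_def carrier_serre_module integers_def)
  show "\<one>\<^bsub>add_monoid serre_module\<^esub> \<in> coset_filtration i"
    by (auto simp: coset_filtration_def zero_serre_module intro!: imageI)
  fix z assume "z \<in> coset_filtration i"
  then obtain y where y: "z = order_coset y" "absv y \<le> absv ?u" by (auto simp: coset_filtration_def)
  show "inv\<^bsub>add_monoid serre_module\<^esub> z \<in> coset_filtration i"
    using y int[OF y(2)] by (auto simp: inv_serre_module coset_filtration_def intro!: imageI)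
  show "z \<otimes>\<^bsub>add_monoid serre_module\<^esub> z' \<in> coset_filtration i" if "z' \<in> coset_filtration i" for z'
    using that y by (auto simp: coset_filtration_def add_serre_module intro!: imageI absv_add_le)
  show "t \<odot>\<^bsub>serre_module\<^esub> z \<in> coset_filtration i" if "t \<in> carrier (ring_on integers)" for t
    using that y by (auto simp: coset_filtration_def smult_serre_module ring_on_def integers_def intro!: imageI absv_mult_le)
qed

lemma coset_filtration_strict:
  assumes "i < s"
  shows "coset_filtration i \<subset> coset_filtration (Suc i)"
proof -
  let ?u = "uniformizer :: 'a"
  have lt: "absv (?u ^ (s - i)) < absv (?u ^ (s - Suc i))"
    unfolding absv_uniformizer_power_less_iff using assms by linarith
  then have "coset_filtration i \<subseteq> coset_filtration (Suc i)"
    unfolding coset_filtration_def by (intro image_mono) auto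
  moreover have "order_coset (?u ^ (s - Suc i)) \<in> coset_filtration (Suc i)"
    by (auto simp: coset_filtration_def intro!: imageI)
  moreover have "order_coset (?u ^ (s - Suc i)) \<notin> coset_filtration i"
  proof
    assume "order_coset (?u ^ (s - Suc i)) \<in> coset_filtration i"
    then obtain y where y: "absv y \<le> absv (?u ^ (s - i))"
      and d: "absv (?u ^ (s - Suc i) - y) \<le> absv (?u ^ s)"
      by (auto simp: coset_filtration_def order_coset_eq_iff)
    have "absv (?u ^ s) \<le> absv (?u ^ (s - i))" unfolding absv_uniformizer_power_le_iff by simp
    with d y have "absv (?u ^ (s - Suc i)) \<le> absv (?u ^ (s - i))"
      using absv_add_le[of "?u ^ (s - Suc i) - y" "absv (?u ^ (s - i))" y] by simp
    with lt show False by simp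
  qed
  ultimately show ?thesis by blast
qed

theorem module_length_serre_module: "module_length (ring_on integers) serre_module = enat s"
  unfolding module_length_def
proof (rule antisym)
  show "Sup {enat k |k. \<exists>C :: nat \<Rightarrow> 'a poly set set set. (\<forall>i\<le>k. submodule (C i) (ring_on integers) serre_module) \<and>
      (\<forall>i<k. C i \<subset> C (Suc i))} \<le> enat s"
    by (rule Sup_least) (use submodule_chain_length_le in fastforce)
  show "enat s \<le> Sup {enat k |k. \<exists>C :: nat \<Rightarrow> 'a poly set set set. (\<forall>i\<le>k. submodule (C i) (ring_on integers) serre_module) \<and>
      (\<forall>i<k. C i \<subset> C (Suc i))}"
    using submodule_coset_filtration coset_filtration_strict by (intro Sup_upper) blast
qed

end


section \<open>The quotient form on the fibres for two by two matrices\<close>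

lemma det_two_by_two:
  fixes A :: "'b::comm_ring_1 mat"
  assumes A: "A \<in> carrier_mat 2 2"
  shows "Determinant.det A = A $$ (0,0) * A $$ (1,1) - A $$ (0,1) * A $$ (1,0)"
proof -
  have d: "Determinant.det (mat_delete A 0 j) = mat_delete A 0 j $$ (0,0)" for j
    using A by (intro det_single) (auto simp: mat_delete_def)
  show ?thesis
    using laplace_expansion_row[OF A, of 0] A
    by (simp add: numeral_2_eq_2 cofactor_def d) (simp add: mat_delete_def)
qed

lemma det_unit_row:
  fixes A :: "'b::comm_ring_1 mat"
  assumes A: "A \<in> carrier_mat n n" and i: "i < n" and k: "k < n"
    and row: "\<And>j. j < n \<Longrightarrow> A $$ (i,j) = (if j = k then 1 else 0)"
  shows "Determinant.det A = cofactor A i k"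
proof -
  have "Determinant.det A = (\<Sum>j<n. (if j = k then cofactor A i j else 0))"
    unfolding laplace_expansion_row[OF A i] by (intro sum.cong) (auto simp: row)
  then show ?thesis using k by (simp add: sum.delta)
qed

lemma char_poly_two_by_two:
  fixes A :: "'b::comm_ring_1 mat"
  assumes A: "A \<in> carrier_mat 2 2"
  shows "char_poly A = [: A $$ (0,0) * A $$ (1,1) - A $$ (0,1) * A $$ (1,0), - (A $$ (0,0) + A $$ (1,1)), 1 :]"
proof -
  have "char_poly A = Determinant.det (char_poly_matrix A)" by (simp add: char_poly_def)
  also have "\<dots> = [: A $$ (0,0) * A $$ (1,1) - A $$ (0,1) * A $$ (1,0), - (A $$ (0,0) + A $$ (1,1)), 1 :]"
    using A by (subst det_two_by_two) (auto simp: char_poly_matrix_def)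
  finally show ?thesis .
qed

lemma elements_mat_subset_iff:
  assumes A: "A \<in> carrier_mat m n"
  shows "elements_mat A \<subseteq> S \<longleftrightarrow> (\<forall>i<m. \<forall>j<n. A $$ (i,j) \<in> S)"
proof (intro iffI allI impI subsetI)
  show "A $$ (i,j) \<in> S" if "elements_mat A \<subseteq> S" "i < m" "j < n" for i j
    using that elements_matI[OF A that(2,3) refl] by blast
  show "x \<in> S" if "\<forall>i<m. \<forall>j<n. A $$ (i,j) \<in> S" "x \<in> elements_mat A" for x
    using that A elements_matD[OF that(2)] by auto
qed

lemma matrix_indices_two: "matrix_indices 2 = [(0,0), (0,1), (1,0), (1,1)]"
  by (simp add: matrix_indices_def numeral_2_eq_2)

text \<open>Modulo dx_00 and dx_01, dc_1 is - dx_11 and dc_2 is x_00 dx_11 - x_01 dx_10, so their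
  wedge product is - x_01 times dx_10 \<and> dx_11.\<close>

lemma wedge_coeff_two_by_two:
  fixes X :: "'b::comm_ring_1 mat"
  shows "wedge_coeff 2 [(0,0), (0,1)] X = - (X $$ (0,1))"
proof -
  define M where "M = mat_of_rows 4
    [d_charpoly_coeff 2 1 X, d_charpoly_coeff 2 2 X, d_coordinate 2 (0,0), d_coordinate 2 (0,1)]"
  have M: "M \<in> carrier_mat 4 4" by (rule carrier_matI) (simp_all add: M_def)
  have less4: "j = 0 \<or> j = 1 \<or> j = 2 \<or> j = 3" if "j < 4" for j :: nat using that by linarith
  have partial: "partial_charpoly_coeff 2 1 p X = - (of_bool (p = (0,0)) + of_bool (p = (1,1)))"
    "partial_charpoly_coeff 2 2 p X = X $$ (0,0) * of_bool (p = (1,1)) + X $$ (1,1) * of_bool (p = (0,0)) -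
       X $$ (0,1) * of_bool (p = (1,0)) - X $$ (1,0) * of_bool (p = (0,1))" for p
    unfolding partial_charpoly_coeff_def by (subst char_poly_two_by_two, simp, simp)+
  have row: "M $$ (3, j) = (if j = 1 then 1 else 0)" "M $$ (2, j) = (if j = 0 then 1 else 0)" if "j < 4" for j
    using less4[OF that]
    by (auto simp: M_def mat_of_rows_index d_coordinate_def matrix_indices_two)
  have vals: "M $$ (0,2) = 0" "M $$ (0,3) = - 1" "M $$ (1,2) = - (X $$ (0,1))"
    by (simp_all add: M_def mat_of_rows_index d_charpoly_coeff_def matrix_indices_two partial[unfolded One_nat_def])
  define N where "N = mat_delete M 3 1"
  have N: "N \<in> carrier_mat 3 3" using M by (auto simp: N_def mat_delete_def)
  have N_entry: "N $$ (i, j) = M $$ (i, if j < 1 then j else Suc j)" if "i < 3" "j < 3" for i j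
    using that M by (simp add: N_def mat_delete_def)
  \<comment> \<open>The unit entries of the two coordinate rows sit at (3,1) and (2,0), both of even
    index sum, so neither cofactor brings a sign.\<close>
  have "Determinant.det M = Determinant.det N"
    using det_unit_row[OF M, of 3 1] row(1) by (simp add: cofactor_def N_def)
  also have "\<dots> = Determinant.det (mat_delete N 2 0)"
    using det_unit_row[OF N, of 2 0] row(2) by (simp add: cofactor_def N_entry)
  also have "\<dots> = M $$ (0,2) * M $$ (1,3) - M $$ (0,3) * M $$ (1,2)"
    using N by (subst det_two_by_two) (auto simp: mat_delete_def N_entry numeral_2_eq_2 numeral_3_eq_3)
  finally have "Determinant.det M = - (X $$ (0,1))" unfolding vals by simp
  moreover have "[1..<2 + 1] = [1, 2::nat]" by (simp add: upt_rec)
  ultimately show ?thesis by (simp add: wedge_coeff_def M_def)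
qed

section \<open>The integral fibre in the chart given by the first row\<close>

locale quadratic_chart = quadratic_reduction b c a0 s + normalized_haar_measure \<mu>
  for b c a0 :: "'a::nonarch_local_field" and s \<mu> +
  fixes \<nu> :: "'a mat measure"
  assumes quotient_form: "quotient_form_measure 2 qpoly \<mu> \<nu>"
begin

text \<open>The trace determines the lower right entry, integrally, and substituting it turns the
  determinant condition into x_01 x_10 = - f(x_00).\<close>

lemma mem_integral_fiber_iff:
  "X \<in> integral_fiber 2 qpoly \<longleftrightarrow> X \<in> carrier_mat 2 2 \<and> absv (X $$ (0,0)) \<le> 1 \<and> absv (X $$ (0,1)) \<le> 1 \<and>
    absv (X $$ (1,0)) \<le> 1 \<and> X $$ (1,1) = 2 * a0 - b * uniformizer ^ s - X $$ (0,0) \<and>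
    X $$ (0,1) * X $$ (1,0) = - quad (X $$ (0,0))" (is "_ \<longleftrightarrow> ?R")
proof -
  have less2: "i < 2 \<longleftrightarrow> i = 0 \<or> i = 1" for i :: nat by auto
  have fib: "X \<in> fiber 2 qpoly \<longleftrightarrow> X \<in> carrier_mat 2 2 \<and> X $$ (1,1) = 2 * a0 - b * uniformizer ^ s - X $$ (0,0) \<and>
    X $$ (0,1) * X $$ (1,0) = - quad (X $$ (0,0))"
  proof (cases "X \<in> carrier_mat 2 2")
    case True
    let ?a = "X $$ (0,0)" and ?d = "X $$ (1,1)" and ?bc = "X $$ (0,1) * X $$ (1,0)"
    let ?t = "b * uniformizer ^ s - 2 * a0"
    have q: "quad ?a = ?a\<^sup>2 + ?t * ?a + (a0\<^sup>2 - b * uniformizer ^ s * a0 + c * uniformizer ^ (2 * s))"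
      unfolding quad_def by (simp add: algebra_simps power2_eq_square)
    have "X \<in> fiber 2 qpoly \<longleftrightarrow> - (?a + ?d) = ?t \<and>
        ?a * ?d - ?bc = a0\<^sup>2 - b * uniformizer ^ s * a0 + c * uniformizer ^ (2 * s)"
      using True by (auto simp: fiber_def char_poly_two_by_two qpoly_def)
    also have "- (?a + ?d) = ?t \<longleftrightarrow> ?d = - ?t - ?a" by (auto simp: algebra_simps)
    also have "?d = - ?t - ?a \<and> ?a * ?d - ?bc = a0\<^sup>2 - b * uniformizer ^ s * a0 + c * uniformizer ^ (2 * s) \<longleftrightarrow>
        ?d = - ?t - ?a \<and> ?bc = - quad ?a"
    proof (rule conj_cong[OF refl])
      assume d: "?d = - ?t - ?a"
      have "?a * (- ?t - ?a) - (a0\<^sup>2 - b * uniformizer ^ s * a0 + c * uniformizer ^ (2 * s)) = - quad ?a"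
        unfolding q by (simp add: algebra_simps power2_eq_square)
      moreover have "x - y = v \<longleftrightarrow> y = x - v" for x y v :: 'a by auto
      ultimately show "?a * ?d - ?bc = a0\<^sup>2 - b * uniformizer ^ s * a0 + c * uniformizer ^ (2 * s) \<longleftrightarrow> ?bc = - quad ?a"
        unfolding d by metis
    qed
    finally show ?thesis using True by simp
  qed (simp add: fiber_def)
  have "absv (2 * a0 - b * uniformizer ^ s - X $$ (0,0)) \<le> 1" if "absv (X $$ (0,0)) \<le> 1"
    by (intro absv_diff_le absv_mult_le_one absv_numeral_two_le a0_integral b_integral uniformizer_integral that)
  moreover have "elements_mat X \<subseteq> integers \<longleftrightarrow> (\<forall>i<2. \<forall>j<2. absv (X $$ (i,j)) \<le> 1)" if "X \<in> carrier_mat 2 2"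
    using elements_mat_subset_iff[OF that, of integers] unfolding integers_def by simp
  ultimately show ?thesis
    unfolding integral_fiber_def mem_Collect_eq fib by (auto simp: less2)
qed

lemma integral_fiber_measurable: "integral_fiber 2 qpoly \<in> sets \<nu>"
proof -
  let ?I = "set (matrix_indices 2)" and ?M = "\<Pi>\<^sub>M p \<in> set (matrix_indices 2). (borel :: 'a measure)"
  have "integers \<in> sets (borel :: 'a measure)"
    unfolding cball_integers[symmetric] by simp
  then have "(\<Pi>\<^sub>E p\<in>?I. integers) \<in> sets ?M"
    by (intro sets_PiM_I_finite) simp_all
  then have "coordinates (matrix_indices 2) -` (\<Pi>\<^sub>E p\<in>?I. integers) \<inter> fiber 2 qpoly \<in> sets (fiber_borel 2 qpoly)"
    unfolding fiber_borel_def by (rule in_vimage_algebra)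
  moreover have "coordinates (matrix_indices 2) -` (\<Pi>\<^sub>E p\<in>?I. integers) \<inter> fiber 2 qpoly = integral_fiber 2 qpoly"
  proof -
    have less2: "i < 2 \<longleftrightarrow> i = 0 \<or> i = 1" for i :: nat by auto
    have "coordinates (matrix_indices 2) X \<in> (\<Pi>\<^sub>E p\<in>?I. integers) \<longleftrightarrow> elements_mat X \<subseteq> integers"
      if "X \<in> carrier_mat 2 2" for X :: "'a mat"
      unfolding coordinates_def restrict_PiE_iff elements_mat_subset_iff[OF that]
      by (auto simp: matrix_indices_two less2)
    then have "X \<in> fiber 2 qpoly \<Longrightarrow>
        coordinates (matrix_indices 2) X \<in> (\<Pi>\<^sub>E p\<in>?I. integers) \<longleftrightarrow> elements_mat X \<subseteq> integers" for X
      by (simp add: fiber_def)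
    then show ?thesis
      unfolding integral_fiber_def by (intro Set.set_eqI) (simp only: Int_iff vimage_eq mem_Collect_eq conj_commute cong: conj_cong)
  qed
  ultimately show ?thesis
    using quotient_form by (simp add: quotient_form_measure_def)
qed

abbreviation "chart \<equiv> [(0::nat,0::nat), (0,1)]"

text \<open>The chart image of the integral matrices with |x_01| = |\<pi>^k|: the lower left entry -
  f(x_00) / x_01 is then integral iff |f(x_00)| \<le> |\<pi>^k|.\<close>

definition chart_box :: "nat \<Rightarrow> (nat \<times> nat \<Rightarrow> 'a) set" where
  "chart_box k = (\<Pi>\<^sub>E p\<in>set chart. if p = (0,0) then sublevel k else {y. absv y = absv (uniformizer ^ k :: 'a)})"

lemma quad_nonzero: "quad a \<noteq> 0"
proof -
  have "quad (a0 + uniformizer ^ s * ((a - a0) / uniformizer ^ s)) \<noteq> 0"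
    unfolding quad_scaled using no_root[of "(a - a0) / uniformizer ^ s"] by simp
  then show ?thesis by simp
qed

text \<open>A zero there would make x_00 a root of f. Hence the chart, whose
  \<open>wedge_coeff\<close> is - x_01, is valid on the whole integral fibre.\<close>

lemma integral_fiber_nonzero: "X \<in> integral_fiber 2 qpoly \<Longrightarrow> X $$ (0,1) \<noteq> 0"
  using quad_nonzero unfolding mem_integral_fiber_iff by (metis mult_zero_left neg_equal_0_iff_equal)

lemma coordinates_chart_eq_iff:
  "coordinates chart X = coordinates chart Y \<longleftrightarrow> X $$ (0,0) = Y $$ (0,0) \<and> X $$ (0,1) = Y $$ (0,1)"
  by (auto simp: coordinates_def restrict_def fun_eq_iff split: if_splits)

lemma inj_on_chart: "inj_on (coordinates chart) (integral_fiber 2 qpoly)"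
proof (rule inj_onI)
  fix X Y assume X: "X \<in> integral_fiber 2 qpoly" and Y: "Y \<in> integral_fiber 2 qpoly"
    and "coordinates chart X = coordinates chart Y"
  then have eq: "X $$ (0,0) = Y $$ (0,0)" "X $$ (0,1) = Y $$ (0,1)" by (simp_all only: coordinates_chart_eq_iff)
  have "X $$ (0,1) * X $$ (1,0) = X $$ (0,1) * Y $$ (1,0)" "X $$ (1,1) = Y $$ (1,1)"
    using X Y eq by (simp_all add: mem_integral_fiber_iff)
  with integral_fiber_nonzero[OF X] have "X $$ (1,0) = Y $$ (1,0)" "X $$ (1,1) = Y $$ (1,1)" by simp_all
  moreover have "X \<in> carrier_mat 2 2" "Y \<in> carrier_mat 2 2" using X Y by (simp_all add: mem_integral_fiber_iff)
  ultimately show "X = Y" using eq by (intro eq_matI) (auto simp: less_2_cases_iff)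
qed

lemma chart_box_subset: "chart_box k \<subseteq> coordinates chart ` integral_fiber 2 qpoly"
proof
  let ?u = "uniformizer ^ k :: 'a"
  fix z assume z: "z \<in> chart_box k"
  then have z00: "absv (z (0,0)) \<le> 1" "absv (quad (z (0,0))) \<le> absv ?u" and z01: "absv (z (0,1)) = absv ?u"
    by (auto simp: chart_box_def sublevel_def PiE_iff)
  then have z0: "z (0,1) \<noteq> 0" by force
  \<comment> \<open>The second row is forced by the determinant and the trace.\<close>
  define X where "X = Matrix.mat 2 2 (\<lambda>p. if p = (0,0) then z (0,0) else if p = (0,1) then z (0,1)
    else if p = (1,0) then - quad (z (0,0)) / z (0,1) else 2 * a0 - b * uniformizer ^ s - z (0,0))"
  have "X \<in> integral_fiber 2 qpoly"
    unfolding mem_integral_fiber_iff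
    using z00 z01 z0 uniformizer_integral[of k, where 'a='a] by (simp add: X_def absv_divide)
  moreover have "coordinates chart X = z"
  proof
    fix p show "coordinates chart X p = z p"
      using z by (cases p) (auto simp: coordinates_def X_def chart_box_def PiE_iff extensional_def)
  qed
  ultimately show "z \<in> coordinates chart ` integral_fiber 2 qpoly" by blast
qed

lemma chart_mem_box:
  assumes X: "X \<in> integral_fiber 2 qpoly"
  obtains k where "k < 2 * s + 2" "absv (X $$ (0,1)) = absv (uniformizer ^ k :: 'a)" "coordinates chart X \<in> chart_box k"
proof -
  obtain k where k: "absv (X $$ (0,1)) = absv (uniformizer ^ k :: 'a)"
    using absv_cases[OF integral_fiber_nonzero[OF X]] X by (auto simp: mem_integral_fiber_iff)
  have "absv (quad (X $$ (0,0))) = absv (X $$ (1,0) * X $$ (0,1))"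
    using X by (simp add: mem_integral_fiber_iff mult.commute)
  also have "\<dots> \<le> absv (uniformizer ^ k :: 'a)"
    using X k by (intro absv_mult_le) (simp_all add: mem_integral_fiber_iff)
  finally have sub: "X $$ (0,0) \<in> sublevel k" using X by (simp add: sublevel_def mem_integral_fiber_iff)
  have "k < 2 * s + 2"
  proof (rule ccontr)
    assume "\<not> k < 2 * s + 2"
    then have "k = 2 * s + Suc (Suc (k - 2 * s - 2))" by simp
    with sub sublevel_empty show False by (metis empty_iff)
  qed
  moreover have "coordinates chart X \<in> chart_box k"
    using sub k by (auto simp: coordinates_def chart_box_def PiE_iff)
  ultimately show ?thesis using k that by blast
qed

lemma sublevel_measurable: "sublevel k \<in> sets \<mu>" if "k < 2 * s + 2"
proof (cases "k \<le> 2 * s")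
  case False
  with that have k: "k = 2 * s + 1" by simp
  show ?thesis
  proof (cases "\<exists>y. absv y \<le> 1 \<and> absv (y\<^sup>2 + b * y + c) < 1")
    case True
    then show ?thesis unfolding k using sublevel_ramified by force
  next
    case False
    then have "absv (y\<^sup>2 + b * y + c) = 1" if "absv y \<le> 1" for y
      using value_integral[OF that] that by force
    then show ?thesis unfolding k using sublevel_inert by simp
  qed
qed (simp add: sublevel_low)

text \<open>On the k-th box the density is the constant 1/|\<pi>^k|, while the sphere factor has
  measure |\<pi>^k| (1 - 1/q); the powers of \<pi> cancel.\<close>

theorem emeasure_integral_fiber:
  "emeasure \<nu> (integral_fiber 2 qpoly) =
    (\<Sum>k<2 * s + 2. emeasure \<mu> (sublevel k)) * ennreal (1 - 1 / real (residue_card TYPE('a)))"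
proof -
  let ?W = "integral_fiber 2 qpoly" and ?P = "\<Pi>\<^sub>M p \<in> set chart. \<mu>"
  let ?u = "\<lambda>k. uniformizer ^ k :: 'a"
  let ?r = "1 - 1 / real (residue_card TYPE('a))"
  interpret P: product_sigma_finite "\<lambda>_ :: nat \<times> nat. \<mu>"
    by (simp add: product_sigma_finite_def sigma_finite_haar)
  have "emeasure \<nu> ?W = (\<integral>\<^sup>+ z. ennreal (1 / absv (wedge_coeff 2 chart (inv_into ?W (coordinates chart) z))) *
      indicator (coordinates chart ` ?W) z \<partial>?P)"
  proof -
    have "distinct chart" "set chart \<subseteq> set (matrix_indices 2)" "length chart = 2 * 2 - 2"
      by (auto simp: matrix_indices_two)
    moreover have "\<forall>X\<in>?W. wedge_coeff 2 chart X \<noteq> 0"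
      using integral_fiber_nonzero by (auto simp: wedge_coeff_two_by_two simp del: One_nat_def)
    ultimately show ?thesis
      using quotient_form integral_fiber_measurable inj_on_chart unfolding quotient_form_measure_def by blast
  qed
  \<comment> \<open>The boxes are disjoint and cover exactly the chart image; those with k \<ge> 2 s
    + 2 are empty, so the integrand is a finite step function.\<close>
  also have "\<dots> = (\<integral>\<^sup>+ z. (\<Sum>k<2 * s + 2. ennreal (1 / absv (?u k)) * indicator (chart_box k) z) \<partial>?P)"
  proof (intro nn_integral_cong)
    fix z
    show "ennreal (1 / absv (wedge_coeff 2 chart (inv_into ?W (coordinates chart) z))) *
        indicator (coordinates chart ` ?W) z = (\<Sum>k<2 * s + 2. ennreal (1 / absv (?u k)) * indicator (chart_box k) z)"
    proof (cases "z \<in> coordinates chart ` ?W")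
      case True
      then obtain X where X: "X \<in> ?W" "z = coordinates chart X" by blast
      obtain k where k: "k < 2 * s + 2" "absv (X $$ (0,1)) = absv (?u k)" "z \<in> chart_box k"
        using chart_mem_box[OF X(1)] X(2) by metis
      have "z \<in> chart_box j \<longleftrightarrow> j = k" for j
      proof
        assume "z \<in> chart_box j"
        then have "absv (?u j) = absv (?u k)" using k(3) by (simp add: chart_box_def PiE_iff)
        then show "j = k"
          using absv_uniformizer_power_le_iff[of j k, where 'a='a] absv_uniformizer_power_le_iff[of k j, where 'a='a]
          by simp
      qed (use k in simp)
      then have "(\<Sum>j<2 * s + 2. ennreal (1 / absv (?u j)) * indicator (chart_box j) z) =
          (\<Sum>j<2 * s + 2. if j = k then ennreal (1 / absv (?u j)) else 0)"
        by (intro sum.cong refl) (simp add: indicator_def)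
      also have "\<dots> = ennreal (1 / absv (X $$ (0,1)))" using k by (subst sum.delta) simp_all
      finally have sum: "(\<Sum>j<2 * s + 2. ennreal (1 / absv (?u j)) * indicator (chart_box j) z) = ennreal (1 / absv (X $$ (0,1)))" .
      have inv: "inv_into ?W (coordinates chart) z = X"
        unfolding X(2) by (rule inv_into_f_f[OF inj_on_chart X(1)])
      show ?thesis using True unfolding sum inv wedge_coeff_two_by_two absv_minus by simp
    next
      case False
      then have "z \<notin> chart_box k" for k using chart_box_subset by blast
      with False show ?thesis by simp
    qed
  qed
  also have "\<dots> = (\<Sum>k<2 * s + 2. emeasure \<mu> (sublevel k) * ennreal ?r)"
  proof -
    have box_integral: "(\<integral>\<^sup>+ z. ennreal (1 / absv (?u k)) * indicator (chart_box k) z \<partial>?P) = emeasure \<mu> (sublevel k) * ennreal ?r"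
      and meas: "chart_box k \<in> sets ?P" if k: "k < 2 * s + 2" for k
    proof -
      let ?B = "\<lambda>p :: nat \<times> nat. if p = (0,0) then sublevel k else {y. absv y = absv (?u k)}"
      have B: "?B p \<in> sets \<mu>" for p using sublevel_measurable[OF k] sphere_measurable[of k] by simp
      show meas: "chart_box k \<in> sets ?P" unfolding chart_box_def by (intro sets_PiM_I_finite) (use B in simp_all)
      have u: "absv (?u k) > 0" by simp
      have r: "?r \<ge> 0" using residue_card_ge_2[where 'a='a] by simp
      have "emeasure ?P (chart_box k) = (\<Prod>p\<in>set chart. emeasure \<mu> (?B p))"
        unfolding chart_box_def by (intro P.emeasure_PiM) (use B in simp_all)
      also have "\<dots> = emeasure \<mu> (sublevel k) * ennreal (absv (?u k) * ?r)"
        by (simp add: emeasure_sphere)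
      finally have "(\<integral>\<^sup>+ z. ennreal (1 / absv (?u k)) * indicator (chart_box k) z \<partial>?P) =
          ennreal (1 / absv (?u k)) * (emeasure \<mu> (sublevel k) * ennreal (absv (?u k) * ?r))"
        using meas by (simp add: nn_integral_cmult_indicator)
      also have "\<dots> = emeasure \<mu> (sublevel k) * (ennreal (1 / absv (?u k)) * ennreal (absv (?u k) * ?r))"
        by (simp only: mult.left_commute)
      also have "ennreal (1 / absv (?u k)) * ennreal (absv (?u k) * ?r) = ennreal ?r"
        using u r by (subst ennreal_mult[symmetric]) simp_all
      finally show "(\<integral>\<^sup>+ z. ennreal (1 / absv (?u k)) * indicator (chart_box k) z \<partial>?P) = emeasure \<mu> (sublevel k) * ennreal ?r" .
    qed
    have "(\<integral>\<^sup>+ z. (\<Sum>k<2 * s + 2. ennreal (1 / absv (?u k)) * indicator (chart_box k) z) \<partial>?P) =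
        (\<Sum>k<2 * s + 2. \<integral>\<^sup>+ z. ennreal (1 / absv (?u k)) * indicator (chart_box k) z \<partial>?P)"
      using meas by (intro nn_integral_sum borel_measurable_times_ennreal borel_measurable_indicator) auto
    also have "\<dots> = (\<Sum>k<2 * s + 2. emeasure \<mu> (sublevel k) * ennreal ?r)"
      by (intro sum.cong refl box_integral) simp
    finally show ?thesis .
  qed
  finally show ?thesis by (simp only: sum_distrib_right)
qed

text \<open>The indices 2 m - 1 and 2 m both contribute r^m, so the sum is 1 + 2 (r + ... + r^n),
  and the factor 1 - r telescopes it.\<close>

lemma sum_power_half:
  fixes r :: real
  shows "(1 - r) * (\<Sum>k\<le>2 * n. r ^ ((k + 1) div 2)) = 1 + r - 2 * r ^ (n + 1)"
proof (induction n)
  case (Suc n)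
  have "(\<Sum>k\<le>2 * Suc n. r ^ ((k + 1) div 2)) = (\<Sum>k\<le>2 * n. r ^ ((k + 1) div 2)) + 2 * r ^ (n + 1)"
    by simp
  then show ?case by (simp only: distrib_left Suc.IH) (simp add: algebra_simps)
qed (simp add: algebra_simps)

lemma emeasure_integral_fiber_eq:
  defines "q \<equiv> real (residue_card TYPE('a))"
  shows "emeasure \<nu> (integral_fiber 2 qpoly) =
    (if unramified qpoly then ennreal ((q + 1) / q - 2 / q ^ (s + 1))
     else ennreal ((q + 1) / q - (q + 1) / q ^ (s + 2)))"
proof -
  have q: "q \<ge> 2" using residue_card_ge_2[where 'a='a] by (simp add: q_def)
  let ?r = "1 / q"
  have absv_u: "absv (uniformizer ^ k :: 'a) = ?r ^ k" for k
    by (simp add: absv_power absv_uniformizer_eq q_def)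
  have r: "1 - ?r \<ge> 0" using q by simp
  let ?S = "\<Sum>k\<le>2 * s. ?r ^ ((k + 1) div 2)"
  have S: "?S \<ge> 0" using q by (intro sum_nonneg) simp
  have low: "(\<Sum>k\<le>2 * s. emeasure \<mu> (sublevel k)) = ennreal ?S"
  proof -
    have "(\<Sum>k\<le>2 * s. emeasure \<mu> (sublevel k)) = (\<Sum>k\<le>2 * s. ennreal (?r ^ ((k + 1) div 2)))"
      unfolding absv_u[symmetric] by (intro sum.cong refl) (simp only: sublevel_low emeasure_cball atMost_iff)
    also have "\<dots> = ennreal ?S" using q by (intro sum_ennreal) simp
    finally show ?thesis .
  qed
  \<comment> \<open>Only the sublevel set at the last index 2 s + 1 depends on ramification.\<close>
  have "{..<2 * s + 2} = insert (2 * s + 1) {..2 * s}" by auto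
  then have split: "(\<Sum>k<2 * s + 2. emeasure \<mu> (sublevel k)) = ennreal ?S + emeasure \<mu> (sublevel (2 * s + 1))"
    by (simp add: low add.commute)
  show ?thesis
  proof (cases "unramified qpoly")
    case True
    then have "sublevel (2 * s + 1) = {}" unfolding unramified_iff by (intro sublevel_inert) blast
    then have "emeasure \<nu> (integral_fiber 2 qpoly) = ennreal (?S * (1 - ?r))"
      unfolding emeasure_integral_fiber split q_def[symmetric] by (simp only: emeasure_empty add_0_right ennreal_mult[OF S r])
    also have "?S * (1 - ?r) = 1 + ?r - 2 * ?r ^ (s + 1)"
      using sum_power_half[of ?r s] by (simp add: mult.commute)
    also have "\<dots> = (q + 1) / q - 2 / q ^ (s + 1)"
      using q by (simp add: power_one_over add_divide_distrib)
    finally show ?thesis using True by simp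
  next
    case False
    then obtain y where y: "absv y \<le> 1" "absv (y\<^sup>2 + b * y + c) \<noteq> 1" unfolding unramified_iff by blast
    then have small: "absv (y\<^sup>2 + b * y + c) < 1" using value_integral[of y] by simp
    have "emeasure \<mu> (sublevel (2 * s + 1)) = ennreal (?r ^ (s + 1))"
      unfolding sublevel_ramified[OF y(1) small] absv_u[symmetric] by (rule emeasure_cball)
    moreover have r': "0 \<le> ?r ^ (s + 1)" using q by simp
    then have S': "0 \<le> ?S + ?r ^ (s + 1)" using S by simp
    ultimately have "emeasure \<nu> (integral_fiber 2 qpoly) = ennreal ((?S + ?r ^ (s + 1)) * (1 - ?r))"
      unfolding emeasure_integral_fiber split q_def[symmetric] by (simp only: ennreal_plus[OF S r'] ennreal_mult[OF S' r])
    also have "(?S + ?r ^ (s + 1)) * (1 - ?r) = (1 - ?r) * ?S + (1 - ?r) * ?r ^ (s + 1)"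
      by (simp add: algebra_simps)
    also have "\<dots> = 1 + ?r - 2 * ?r ^ (s + 1) + (1 - ?r) * ?r ^ (s + 1)"
      unfolding sum_power_half ..
    also have "\<dots> = 1 + ?r - (?r ^ (s + 1) + ?r ^ (s + 2))"
    proof -
      have "1 + x - 2 * x ^ (s + 1) + (1 - x) * x ^ (s + 1) = 1 + x - (x ^ (s + 1) + x ^ (s + 2))" for x :: real
        by (simp add: algebra_simps)
      then show ?thesis .
    qed
    also have "?r ^ (s + 1) + ?r ^ (s + 2) = (q + 1) / q ^ (s + 2)"
      using q by (simp add: power_one_over add_divide_distrib)
    also have "1 + ?r = (q + 1) / q"
      using q by (simp add: add_divide_distrib)
    finally show ?thesis using False by simp
  qed
qed

end


section \<open>Stable orbital integrals of elliptic elements\<close>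

lemma irreducible_quadratic_no_root:
  fixes u w :: "'b::field"
  assumes irred: "irreducible [: w, u, 1 :]"
  shows "z\<^sup>2 + u * z + w \<noteq> 0"
proof
  assume "z\<^sup>2 + u * z + w = 0"
  then have "poly [: w, u, 1 :] z = 0" by (simp add: algebra_simps power2_eq_square)
  then obtain g where g: "[: w, u, 1 :] = [: - z, 1 :] * g"
    unfolding poly_eq_0_iff_dvd by (auto simp: dvd_def)
  then have "g \<noteq> 0" by auto
  then have "Polynomial.degree [: w, u, 1 :] = 1 + Polynomial.degree g"
    unfolding g by (subst degree_mult_eq) simp_all
  then have "Polynomial.degree g = 1" by simp
  moreover have "is_unit [: - z, 1 :] \<or> is_unit g"
    using irreducibleD[OF irred g] .
  ultimately show False using \<open>g \<noteq> 0\<close> by (auto simp: is_unit_iff_degree)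
qed

text \<open>If 2 is invertible, a zero discriminant gives the root - u / 2. In characteristic 2 it
  gives u = 0, so the derivative vanishes and separability would make the polynomial a unit.\<close>

lemma irreducible_separable_discriminant:
  fixes u w :: "'b::field"
  assumes irred: "irreducible [: w, u, 1 :]"
    and separable: "coprime [: w, u, 1 :] (pderiv [: w, u, 1 :])"
  shows "u\<^sup>2 - 4 * w \<noteq> 0"
proof
  assume disc: "u\<^sup>2 - 4 * w = 0"
  have four: "4 = (2 * 2 :: 'b)" by simp
  show False
  proof (cases "(2::'b) = 0")
    case True
    then have "u = 0" using disc unfolding four by simp
    with True have "pderiv [: w, u, 1 :] = 0" by (simp add: pderiv_pCons)
    with separable have "is_unit [: w, u, 1 :]" by simp
    then show False using irred by (simp add: irreducible_def)
  next
    case False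
    define h where "h = - u / 2"
    have u: "u = - 2 * h" using False by (simp add: h_def)
    have "(2 * 2) * (h\<^sup>2 - w) = u\<^sup>2 - 4 * w"
      unfolding u by (simp add: algebra_simps power2_eq_square)
    then have "2 * 2 = (0::'b) \<or> h\<^sup>2 - w = 0" unfolding disc mult_eq_0_iff .
    then have "w = h\<^sup>2" using False unfolding mult_eq_0_iff by simp
    then have "h\<^sup>2 + u * h + w = 0" unfolding u by (simp add: power2_eq_square)
    with irreducible_quadratic_no_root[OF irred] show False by blast
  qed
qed

theorem theorem5p4:
  fixes \<gamma> :: "'a::nonarch_local_field mat"
    and \<mu> :: "'a measure" and \<nu> :: "'a mat measure"
    and q :: real and S :: nat
  assumes "\<gamma> \<in> carrier_mat 2 2" and "elements_mat \<gamma> \<subseteq> integers"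
    and "irreducible (char_poly \<gamma>)"
    and "coprime (char_poly \<gamma>) (pderiv (char_poly \<gamma>))"
    and "normalized_haar \<mu>"
    and "quotient_form_measure 2 (char_poly \<gamma>) \<mu> \<nu>"
    and "q = real (residue_card TYPE('a))"
    and "S = serre_invariant \<gamma>"
  shows "(unramified (char_poly \<gamma>) \<longrightarrow>
      stable_orbital_integral \<nu> \<gamma> =
        ennreal (1 / q ^ S * ((q - 1) / q) * (1 + (q + 1) * ((q ^ S - 1) / (q - 1)))) \<and>
      1 / q ^ S * ((q - 1) / q) * (1 + (q + 1) * ((q ^ S - 1) / (q - 1))) =
        (q + 1) / q - 2 / q ^ (S + 1)) \<and>
    (\<not> unramified (char_poly \<gamma>) \<longrightarrow>
      stable_orbital_integral \<nu> \<gamma> =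
        ennreal (1 / q ^ S * ((q\<^sup>2 - 1) / q\<^sup>2) * ((q ^ (S + 1) - 1) / (q - 1))) \<and>
      1 / q ^ S * ((q\<^sup>2 - 1) / q\<^sup>2) * ((q ^ (S + 1) - 1) / (q - 1)) =
        (q + 1) / q - (q + 1) / q ^ (S + 2))"
proof -
  let ?f = "char_poly \<gamma>"
  define w where "w = \<gamma> $$ (0,0) * \<gamma> $$ (1,1) - \<gamma> $$ (0,1) * \<gamma> $$ (1,0)"
  define u where "u = - (\<gamma> $$ (0,0) + \<gamma> $$ (1,1))"
  have f: "?f = [: w, u, 1 :]"
    unfolding w_def u_def by (rule char_poly_two_by_two[OF assms(1)])
  have entries: "absv (\<gamma> $$ (i,j)) \<le> 1" if "i < 2" "j < 2" for i j
    using assms(2) that elements_mat_subset_iff[OF assms(1), of integers] by (auto simp: integers_def)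
  have integral: "absv u \<le> 1" "absv w \<le> 1"
    unfolding u_def w_def absv_minus
    by (intro absv_add_le absv_diff_le absv_mult_le_one entries; simp)+
  \<comment> \<open>Irreducibility supplies the absence of roots, and together with separability the
    nonzero discriminant.\<close>
  obtain b c a0 s where red: "quadratic_reduction b c a0"
    and u: "u = b * uniformizer ^ s - 2 * a0"
    and w: "w = a0\<^sup>2 - b * uniformizer ^ s * a0 + c * uniformizer ^ (2 * s)"
    using quadratic_reduction_exists[OF integral irreducible_quadratic_no_root irreducible_separable_discriminant]
      assms(3,4) unfolding f by blast
  interpret quadratic_reduction b c a0 s by (rule red)
  have fq: "?f = qpoly" unfolding f u w qpoly_def ..
  interpret quadratic_chart b c a0 s \<mu> \<nu>
    using assms(5,6) unfolding fq by unfold_locales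
  have S: "S = s"
    unfolding assms(8) serre_invariant_def fq module_length_serre_module by simp
  have so: "stable_orbital_integral \<nu> \<gamma> = emeasure \<nu> (integral_fiber 2 qpoly)"
    using assms(1) by (simp add: stable_orbital_integral_def fq)
  have q: "q \<ge> 2" using residue_card_ge_2[where 'a='a] assms(7) by simp
  have 1: "1 / q ^ S * ((q - 1) / q) * (1 + (q + 1) * ((q ^ S - 1) / (q - 1))) = (q + 1) / q - 2 / q ^ (S + 1)"
  proof -
    have "1 / q ^ S * ((q - 1) / q) * (1 + (q + 1) * ((q ^ S - 1) / (q - 1))) =
        ((q - 1) + (q + 1) * (q ^ S - 1)) / (q ^ S * q)"
      using q by (simp add: distrib_left add_divide_distrib)
    also have "(q - 1) + (q + 1) * (q ^ S - 1) = (q + 1) * q ^ S - 2"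
      by (simp add: algebra_simps)
    also have "((q + 1) * q ^ S - 2) / (q ^ S * q) = (q + 1) / q - 2 / q ^ (S + 1)"
      using q by (simp add: diff_divide_distrib mult.commute)
    finally show ?thesis .
  qed
  have 2: "1 / q ^ S * ((q\<^sup>2 - 1) / q\<^sup>2) * ((q ^ (S + 1) - 1) / (q - 1)) = (q + 1) / q - (q + 1) / q ^ (S + 2)"
  proof -
    have fac: "q\<^sup>2 - 1 = (q + 1) * (q - 1)" by (simp add: algebra_simps power2_eq_square)
    have "1 / q ^ S * ((q\<^sup>2 - 1) / q\<^sup>2) * ((q ^ (S + 1) - 1) / (q - 1)) =
        (q + 1) * (q ^ (S + 1) - 1) / (q ^ S * q\<^sup>2)"
      unfolding fac using q by simp
    also have "\<dots> = ((q + 1) * q ^ (S + 1) - (q + 1)) / q ^ (S + 2)"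
      by (simp only: right_diff_distrib power_add mult_1_right)
    also have "\<dots> = (q + 1) / q - (q + 1) / q ^ (S + 2)"
      using q by (simp add: diff_divide_distrib)
    finally show ?thesis .
  qed
  show ?thesis
    using emeasure_integral_fiber_eq unfolding so 1 2 unfolding S fq assms(7)[symmetric] by simp
qed

end
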